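(* Let $k,\Delta,d\geq 2$. Let $H$ be built by the $2$-step method from a $(d,\Delta)$-bipartite graph $H_0$ using a $[\Delta,k]$-transversal design $T$. (a) Let $Q$ and $Q'$ be distinct blocks of $H_0$ such that there are $\lambda\geq 1$ pairwise internally-disjoint paths in $H_0$ from $Q$ to $Q'$, each of length at most $\mu$. Then for any block $B_{Q,V}$ of $H$ and any block $B_{Q',V'}$ of $H$ there are $\min\{\Delta,k\}$ pairwise internally-disjoint paths in $H$ from $B_{Q,V}$ to $B_{Q',V'}$. Furthermore, if $\lambda\geq 2$ then there are $\Delta$ pairwise internally-disjoint paths in $H$ from $B_{Q,V}$ to $B_{Q',V'}$. All these paths have length at most $\mu+4$. (b) If $B_{Q,V}$ and $B_{Q,V'}$ are distinct blocks of $H$ (both associated with the same block $Q$ of $H_0$), then there are $\Delta$ pairwise internally-disjoint paths in $H$ from $B_{Q,V}$ to $B_{Q,V'}$, each of length at most $6$ and lying entirely within $T_Q$.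
   Context: All bipartite graphs come with a fixed bipartition into a left side, whose vertices are called nodes, and a right side, whose vertices are called blocks. A $(d,\Delta)$-bipartite graph is one in which every node has degree $d$ and every block has degree (rank) $\Delta$. A $[\Delta,k]$-transversal design ($k,\Delta\ge2$) is a set of $\Delta k$ elements partitioned into $\Delta$ groups $D_1,\ldots,D_\Delta$ of size $k$, with a family of $k^2$ blocks, each a $\Delta$-subset meeting every group in exactly one element, such that every pair of elements from distinct groups lies in exactly one block; it is viewed as a bipartite graph (elements = nodes, blocks = blocks, adjacency = membership). The $2$-step method: let $H_0$ be a connected $(d,\Delta)$-bipartite graph. For each node $p$ of $H_0$ introduce a group $G_p$ of $k$ new nodes. For each block $Q$ of $H_0$, with neighbours $p_1,\ldots,p_\Delta$, introduce a copy $T_Q$ of $T$ whose $\Delta$ groups are identified (via bijections) with $G_{p_1},\ldots,G_{p_\Delta}$ and whose $k^2$ blocks are new blocks $B_{Q,U}$ ($U$ ranging over the blocks of $T$), with $B_{Q,U}$ adjacent to the nodes corresponding to the elements of $U$. The resulting bipartite graph $H$ has node set $\bigcup_p G_p$ and block set $\{B_{Q,U}\}$; distinct copies $T_Q$ have disjoint block sets and edge sets. A path is a sequence of distinct vertices with consecutive ones adjacent; its length is its number of edges. A set of paths is pairwise internally-disjoint if every source or destination appears only as a source or destination, and every other vertex appears on at most one path. *)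

theory Defs
  imports Main "HOL-Library.Disjoint_Sets"
begin

record ('n, 'b) bigraph =
  nodes :: "'n set"
  blocks :: "'b set"
  edges :: "('n \<times> 'b) set"

definition wf_bigraph :: "('n, 'b) bigraph \<Rightarrow> bool" where
  "wf_bigraph H \<longleftrightarrow> edges H \<subseteq> nodes H \<times> blocks H"

text \<open>The two sides are kept apart by the sum type: nodes are tagged \<open>Inl\<close>, blocks \<open>Inr\<close>.\<close>

definition verts :: "('n, 'b) bigraph \<Rightarrow> ('n + 'b) set" where
  "verts H = Inl ` nodes H \<union> Inr ` blocks H"

definition adjacent :: "('n, 'b) bigraph \<Rightarrow> 'n + 'b \<Rightarrow> 'n + 'b \<Rightarrow> bool" where
  "adjacent H u v \<longleftrightarrow> (\<exists>p Q. (p, Q) \<in> edges H \<and> {u, v} = {Inl p, Inr Q})"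

definition block_nbrs :: "('n, 'b) bigraph \<Rightarrow> 'b \<Rightarrow> 'n set" where
  "block_nbrs H Q = {p. (p, Q) \<in> edges H}"

definition node_nbrs :: "('n, 'b) bigraph \<Rightarrow> 'n \<Rightarrow> 'b set" where
  "node_nbrs H p = {Q. (p, Q) \<in> edges H}"

definition biregular :: "nat \<Rightarrow> nat \<Rightarrow> ('n, 'b) bigraph \<Rightarrow> bool" where
  "biregular d \<Delta> H \<longleftrightarrow> wf_bigraph H \<and>
     (\<forall>p \<in> nodes H. finite (node_nbrs H p) \<and> card (node_nbrs H p) = d) \<and>
     (\<forall>Q \<in> blocks H. finite (block_nbrs H Q) \<and> card (block_nbrs H Q) = \<Delta>)"

definition is_path :: "('n, 'b) bigraph \<Rightarrow> ('n + 'b) list \<Rightarrow> bool" where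
  "is_path H xs \<longleftrightarrow>
     xs \<noteq> [] \<and> set xs \<subseteq> verts H \<and> distinct xs \<and> successively (adjacent H) xs"

definition path_between :: "('n, 'b) bigraph \<Rightarrow> 'n + 'b \<Rightarrow> 'n + 'b \<Rightarrow> ('n + 'b) list \<Rightarrow> bool" where
  "path_between H u v xs \<longleftrightarrow> is_path H xs \<and> hd xs = u \<and> last xs = v"

definition path_length :: "'v list \<Rightarrow> nat" where
  "path_length xs = length xs - 1"

definition connected_bigraph :: "('n, 'b) bigraph \<Rightarrow> bool" where
  "connected_bigraph H \<longleftrightarrow> (\<forall>u \<in> verts H. \<forall>v \<in> verts H. \<exists>xs. path_between H u v xs)"

definition internally_disjoint :: "'v list set \<Rightarrow> bool" where
  "internally_disjoint P \<longleftrightarrow>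
     (let E = hd ` P \<union> last ` P in
       (\<forall>xs \<in> P. set (butlast (tl xs)) \<inter> E = {}) \<and>
       (\<forall>xs \<in> P. \<forall>ys \<in> P. xs \<noteq> ys \<longrightarrow> set xs \<inter> set ys \<subseteq> E))"

definition disjoint_paths ::
  "('n, 'b) bigraph \<Rightarrow> 'n + 'b \<Rightarrow> 'n + 'b \<Rightarrow> nat \<Rightarrow> nat \<Rightarrow> ('n + 'b) list set \<Rightarrow> bool" where
  "disjoint_paths H u v n m P \<longleftrightarrow>
     finite P \<and> card P = n \<and> internally_disjoint P \<and>
     (\<forall>xs \<in> P. path_between H u v xs \<and> path_length xs \<le> m)"

record 'a design =
  elems :: "'a set"
  group :: "nat \<Rightarrow> 'a set"
  dblocks :: "'a set set"

definition transversal_design :: "nat \<Rightarrow> nat \<Rightarrow> 'a design \<Rightarrow> bool" where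
  "transversal_design \<Delta> k T \<longleftrightarrow>
     2 \<le> \<Delta> \<and> 2 \<le> k \<and>
     finite (elems T) \<and> card (elems T) = \<Delta> * k \<and>
     (\<Union>i \<in> {1..\<Delta>}. group T i) = elems T \<and> disjoint_family_on (group T) {1..\<Delta>} \<and>
     (\<forall>i \<in> {1..\<Delta>}. card (group T i) = k) \<and>
     finite (dblocks T) \<and> card (dblocks T) = k ^ 2 \<and>
     (\<forall>U \<in> dblocks T. U \<subseteq> elems T \<and> card U = \<Delta> \<and>
        (\<forall>i \<in> {1..\<Delta>}. card (U \<inter> group T i) = 1)) \<and>
     (\<forall>i \<in> {1..\<Delta>}. \<forall>j \<in> {1..\<Delta>}. i \<noteq> j \<longrightarrow>
        (\<forall>x \<in> group T i. \<forall>y \<in> group T j. \<exists>!U. U \<in> dblocks T \<and> x \<in> U \<and> y \<in> U))"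

definition design_graph :: "'a design \<Rightarrow> ('a, 'a set) bigraph" where
  "design_graph T = \<lparr>nodes = elems T, blocks = dblocks T,
     edges = {(x, U). x \<in> elems T \<and> U \<in> dblocks T \<and> x \<in> U}\<rparr>"

text \<open>
  Data of the 2-step method: \<open>G p\<close> is the group of \<open>k\<close> new nodes introduced for the node \<open>p\<close>;
  for a block \<open>Q\<close>, \<open>\<sigma> Q 1, \<dots>, \<sigma> Q \<Delta>\<close> enumerates its neighbours, and \<open>\<phi> Q\<close>
  identifies the \<open>i\<close>-th group of the design with \<open>G (\<sigma> Q i)\<close>.
\<close>

definition two_step_data ::
  "nat \<Rightarrow> nat \<Rightarrow> ('p, 'q) bigraph \<Rightarrow> 'a design \<Rightarrow> ('p \<Rightarrow> 'v set) \<Rightarrow>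
   ('q \<Rightarrow> nat \<Rightarrow> 'p) \<Rightarrow> ('q \<Rightarrow> 'a \<Rightarrow> 'v) \<Rightarrow> bool" where
  "two_step_data \<Delta> k H\<^sub>0 T G \<sigma> \<phi> \<longleftrightarrow>
     (\<forall>p \<in> nodes H\<^sub>0. finite (G p) \<and> card (G p) = k) \<and>
     disjoint_family_on G (nodes H\<^sub>0) \<and>
     (\<forall>Q \<in> blocks H\<^sub>0. bij_betw (\<sigma> Q) {1..\<Delta>} (block_nbrs H\<^sub>0 Q) \<and>
        (\<forall>i \<in> {1..\<Delta>}. bij_betw (\<phi> Q) (group T i) (G (\<sigma> Q i))))"

text \<open>The copy \<open>T\<^sub>Q\<close> of the design; the block \<open>B\<^sub>Q\<^sub>,\<^sub>U\<close> is the pair \<open>(Q, U)\<close>.\<close>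

definition design_copy ::
  "'a design \<Rightarrow> ('q \<Rightarrow> 'a \<Rightarrow> 'v) \<Rightarrow> 'q \<Rightarrow> ('v, 'q \<times> 'a set) bigraph" where
  "design_copy T \<phi> Q =
     \<lparr>nodes = \<phi> Q ` nodes (design_graph T),
      blocks = Pair Q ` blocks (design_graph T),
      edges = map_prod (\<phi> Q) (Pair Q) ` edges (design_graph T)\<rparr>"

definition two_step ::
  "('p, 'q) bigraph \<Rightarrow> 'a design \<Rightarrow> ('p \<Rightarrow> 'v set) \<Rightarrow> ('q \<Rightarrow> 'a \<Rightarrow> 'v) \<Rightarrow>
   ('v, 'q \<times> 'a set) bigraph" where
  "two_step H\<^sub>0 T G \<phi> =
     \<lparr>nodes = (\<Union>p \<in> nodes H\<^sub>0. G p),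
      blocks = (\<Union>Q \<in> blocks H\<^sub>0. blocks (design_copy T \<phi> Q)),
      edges = (\<Union>Q \<in> blocks H\<^sub>0. edges (design_copy T \<phi> Q))\<rparr>"

end

theory Submission
  imports Defs
begin

text \<open>
  Blocks of one copy: pair the unshared points of \<open>V\<close> and \<open>V'\<close> by a derangement of the groups and join
  each pair by a block; only \<open>\<Delta> = 2\<close> with a shared point needs a detour of length 6.

  Blocks of different copies: choose a path of \<open>H\<^sub>0\<close> without chords at its two ends. The groups above
  its nodes can be linked by \<open>k\<close> disjoint paths, and inside \<open>T\<^sub>Q\<close> and \<open>T\<^sub>Q\<^sub>'\<close> the points of \<open>V\<close> and \<open>V'\<close>
  fan out to the first and the last of these groups. Points common to \<open>V\<close> and \<open>V'\<close> serve as paths of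
  length 2, and their group is then preferred for the remaining ones. Since
  \<open>\<Delta> \<le> k + 1\<close> in a transversal design, a second path of \<open>H\<^sub>0\<close> has to carry at most one further path.
\<close>

section \<open>Walks and families of disjoint paths\<close>

text \<open>The factor k is a bottleneck: all walks that follow one path of \<open>H\<^sub>0\<close>
  pass through groups of k nodes. Chords are harmful because the fan at Q uses points of V above
  further neighbours of Q, and a link entering such a group could hit one of them; if the path meets
  the neighbourhood of Q in a single node, this cannot happen. The same applies at Q'. A block joins
  a point only to points of other groups. So the point of V in the group where the links start
  cannot serve another point of that group, and it has to be the start of a link itself; likewise
  the point of V' in the last group has to be the end of a link. These two demands can be met since
  min {\<Delta>, k} \<ge> 2. The constant 4: a path of length at most \<mu> has at most \<mu> - 1
  inner vertices, a link copies them one for one, and each of the two fans adds at most two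
  vertices.\<close>

lemma adjacent_simps [simp]:
  "adjacent H (Inl p) (Inr Q) \<longleftrightarrow> p \<in> block_nbrs H Q"
  "adjacent H (Inr Q) (Inl p) \<longleftrightarrow> p \<in> block_nbrs H Q"
  "\<not> adjacent H (Inl p) (Inl p')"
  "\<not> adjacent H (Inr Q) (Inr Q')"
  unfolding adjacent_def block_nbrs_def by (auto simp: doubleton_eq_iff)

lemma adjacent_verts:
  assumes "wf_bigraph H" "adjacent H u v"
  shows "u \<in> verts H" "v \<in> verts H"
  using assms unfolding wf_bigraph_def adjacent_def verts_def by (auto simp: doubleton_eq_iff)

lemma successively_verts:
  assumes "wf_bigraph H" "successively (adjacent H) xs" "length xs \<ge> 2"
  shows "set xs \<subseteq> verts H"
  using assms(2,3)
proof (induction xs)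
  case (Cons x xs)
  then obtain y ys where xs: "xs = y # ys" by (cases xs) auto
  have "adjacent H x y" using Cons.prems xs by simp
  then have "x \<in> verts H" "y \<in> verts H" using adjacent_verts[OF assms(1)] by blast+
  then show ?case using Cons xs by (cases ys) auto
qed simp

text \<open>A walk of minimal length among those with interior in the given set has no chord at its ends.\<close>

lemma ex_chordless_walk:
  assumes "successively R (u # xs @ [v])"
  obtains ys where "successively R (u # ys @ [v])" "distinct ys" "set ys \<subseteq> set xs"
    "length ys \<le> length xs"
    "\<And>as z bs. ys = as @ z # bs \<Longrightarrow> R u z \<Longrightarrow> as = []"
    "\<And>as z bs. ys = as @ z # bs \<Longrightarrow> R z v \<Longrightarrow> bs = []"
proof -
  define P where "P ys \<longleftrightarrow> successively R (u # ys @ [v]) \<and> set ys \<subseteq> set xs" for ys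
  define ys where "ys = arg_min length P"
  have "P xs" using assms by (simp add: P_def)
  then have Pys: "P ys" and least: "\<And>zs. P zs \<Longrightarrow> length ys \<le> length zs"
    unfolding ys_def by (auto intro: arg_min_natI arg_min_nat_le)
  show ?thesis
  proof
    show "successively R (u # ys @ [v])" "set ys \<subseteq> set xs" using Pys by (auto simp: P_def)
    show "length ys \<le> length xs" using least[OF \<open>P xs\<close>] .
    show "distinct ys"
    proof (rule ccontr)
      assume "\<not> distinct ys"
      then obtain as z bs cs where ys: "ys = as @ [z] @ bs @ [z] @ cs"
        using not_distinct_decomp by blast
      have "P (as @ [z] @ cs)"
        using Pys unfolding ys P_def
        by (auto simp: successively_append_iff successively_Cons hd_append split: if_splits)
      then show False using least ys by fastforce
    qed
  next
    fix as z bs assume ys: "ys = as @ z # bs" and "R u z"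
    then have "P (z # bs)"
      using Pys unfolding P_def by (auto simp: successively_append_iff successively_Cons)
    then show "as = []" using least ys by fastforce
  next
    fix as z bs assume ys: "ys = as @ z # bs" and "R z v"
    then have "P (as @ [z])"
      using Pys unfolding P_def
      by (auto simp: successively_append_iff successively_Cons hd_append split: if_splits)
    then show "bs = []" using least ys by fastforce
  qed
qed

text \<open>The walks constructed later may repeat a vertex; each is replaced by a path inside its
  own vertex set, which preserves disjointness. Since u and v are not adjacent, every interior is
  nonempty, so different indices give different paths and the count is right. The length bound is
  strict because n inner vertices make a path of length n + 1.\<close>

lemma disjoint_pathsI_walks:
  assumes wf: "wf_bigraph H" and "finite X" and "u \<noteq> v" and nadj: "\<not> adjacent H u v"
    and walk: "\<And>x. x \<in> X \<Longrightarrow> successively (adjacent H) (u # W x @ [v])"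
    and len: "\<And>x. x \<in> X \<Longrightarrow> length (W x) < m"
    and uv: "\<And>x. x \<in> X \<Longrightarrow> u \<notin> set (W x) \<and> v \<notin> set (W x)"
    and disj: "\<And>x y. x \<in> X \<Longrightarrow> y \<in> X \<Longrightarrow> x \<noteq> y \<Longrightarrow> set (W x) \<inter> set (W y) = {}"
  shows "\<exists>P. disjoint_paths H u v (card X) m P"
proof -
  have "\<exists>ys. successively (adjacent H) (u # ys @ [v]) \<and> distinct ys \<and> set ys \<subseteq> set (W x)
      \<and> length ys \<le> length (W x)" if "x \<in> X" for x
    by (rule ex_chordless_walk[OF walk[OF that]]) blast
  then obtain Y where Y: "\<And>x. x \<in> X \<Longrightarrow> successively (adjacent H) (u # Y x @ [v])"
    "\<And>x. x \<in> X \<Longrightarrow> distinct (Y x)" "\<And>x. x \<in> X \<Longrightarrow> set (Y x) \<subseteq> set (W x)"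
    "\<And>x. x \<in> X \<Longrightarrow> length (Y x) \<le> length (W x)" by metis
  have ne: "Y x \<noteq> []" if "x \<in> X" for x using Y(1)[OF that] nadj by auto
  have Ydisj: "set (Y x) \<inter> set (Y y) = {}" if "x \<in> X" "y \<in> X" "x \<noteq> y" for x y
    using disj[OF that] Y(3) that by blast
  define p where "p x = u # Y x @ [v]" for x
  have inj: "inj_on p X"
  proof (rule inj_onI)
    fix x y assume xy: "x \<in> X" "y \<in> X" "p x = p y"
    then have "Y x = Y y" by (simp add: p_def)
    then show "x = y" using Ydisj[OF xy(1,2)] ne[OF xy(1)] by auto
  qed
  have E: "hd ` p ` X \<union> last ` p ` X \<subseteq> {u, v}" by (auto simp: p_def)
  have "internally_disjoint (p ` X)"
    unfolding internally_disjoint_def Let_def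
  proof (intro conjI ballI impI)
    fix xs assume "xs \<in> p ` X"
    then obtain x where x: "x \<in> X" "xs = p x" by blast
    then have "set (butlast (tl xs)) \<subseteq> set (Y x)" by (simp add: p_def)
    then show "set (butlast (tl xs)) \<inter> (hd ` p ` X \<union> last ` p ` X) = {}"
      using E uv[OF x(1)] Y(3)[OF x(1)] by blast
  next
    fix xs ys assume "xs \<in> p ` X" "ys \<in> p ` X" "xs \<noteq> ys"
    then obtain x y where xy: "x \<in> X" "y \<in> X" "xs = p x" "ys = p y" "x \<noteq> y" by blast
    then have "set xs \<inter> set ys \<subseteq> {u, v}" using Ydisj[of x y] by (auto simp: p_def)
    moreover have "{u, v} \<subseteq> hd ` p ` X \<union> last ` p ` X"
      using xy(1) by (force simp: p_def image_image)
    ultimately show "set xs \<inter> set ys \<subseteq> hd ` p ` X \<union> last ` p ` X" by (rule subset_trans)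
  qed
  moreover have "path_between H u v (p x) \<and> path_length (p x) \<le> m" if x: "x \<in> X" for x
  proof -
    have "set (p x) \<subseteq> verts H"
      using successively_verts[OF wf Y(1)[OF x]] by (simp add: p_def)
    moreover have "distinct (p x)"
      using Y(2,3)[OF x] uv[OF x] \<open>u \<noteq> v\<close> by (auto simp: p_def)
    ultimately show ?thesis
      using Y(1,4)[OF x] len[OF x] by (simp add: p_def path_between_def is_path_def path_length_def)
  qed
  ultimately have "disjoint_paths H u v (card X) m (p ` X)"
    unfolding disjoint_paths_def using \<open>finite X\<close> card_image[OF inj] by auto
  then show ?thesis ..
qed

text \<open>Internal disjointness refers to the ends occurring in the family. Every nonempty
  subfamily still has the ends u and v, so only the empty one needs separate treatment.\<close>

lemma disjoint_paths_fewer: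
  assumes "disjoint_paths H u v n m P" "n' \<le> n"
  shows "\<exists>P. disjoint_paths H u v n' m P"
proof -
  obtain P' where P': "P' \<subseteq> P" "card P' = n'" "finite P'"
    using assms unfolding disjoint_paths_def by (metis obtain_subset_with_card_n)
  have ends: "hd xs = u" "last xs = v" if "xs \<in> P" for xs
    using assms(1) that unfolding disjoint_paths_def path_between_def by auto
  have "internally_disjoint P'"
  proof (cases "P' = {}")
    case False
    then have "hd ` P' \<union> last ` P' = {u, v}" "hd ` P \<union> last ` P = {u, v}"
      using P'(1) ends by fastforce+
    then show ?thesis
      using assms(1) P'(1) unfolding disjoint_paths_def internally_disjoint_def Let_def
      by (metis subsetD)
  qed (simp add: internally_disjoint_def)
  then show ?thesis using P' assms(1) unfolding disjoint_paths_def by blast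
qed

lemma disjoint_paths_supergraph:
  assumes "disjoint_paths K u v n m P" "verts K \<subseteq> verts H" "edges K \<subseteq> edges H"
  shows "disjoint_paths H u v n m P"
proof -
  have "adjacent K x y \<Longrightarrow> adjacent H x y" for x y
    using assms(3) unfolding adjacent_def by blast
  then have "is_path K xs \<Longrightarrow> is_path H xs" for xs
    using assms(2) unfolding is_path_def by (auto intro: successively_mono)
  then show ?thesis using assms(1) unfolding disjoint_paths_def path_between_def by blast
qed

text \<open>The interior of a path from Q to Q' without chords at its ends. Leaving out Q and Q'
  makes a common neighbour alone a route, and the interior is the part that is lifted to H.\<close>

definition route :: "('n, 'b) bigraph \<Rightarrow> 'b \<Rightarrow> 'b \<Rightarrow> 'n \<Rightarrow> 'n \<Rightarrow> ('n + 'b) list \<Rightarrow> bool" where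
  "route H Q Q' p p' ys \<longleftrightarrow> successively (adjacent H) ys \<and> distinct ys \<and> ys \<noteq> [] \<and>
     hd ys = Inl p \<and> last ys = Inl p' \<and> p \<in> block_nbrs H Q \<and> p' \<in> block_nbrs H Q' \<and>
     (\<forall>r \<in> block_nbrs H Q. Inl r \<in> set ys \<longrightarrow> r = p) \<and>
     (\<forall>r \<in> block_nbrs H Q'. Inl r \<in> set ys \<longrightarrow> r = p') \<and> Inr Q \<notin> set ys \<and> Inr Q' \<notin> set ys"

lemma route_singleton:
  "p \<in> block_nbrs H Q \<Longrightarrow> p \<in> block_nbrs H Q' \<Longrightarrow> route H Q Q' p p [Inl p]"
  unfolding route_def by simp

text \<open>Bipartiteness puts nodes at both ends of the interior, and a chordless interior contains
  no further neighbour of Q or Q'. The shortcut uses only vertices of the given path, so internally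
  disjoint paths yield disjoint routes.\<close>

lemma ex_route:
  assumes path: "path_between H (Inr Q) (Inr Q') xs" and "Q \<noteq> Q'"
  obtains p p' ys where "route H Q Q' p p' ys" "set ys \<subseteq> set xs - {Inr Q, Inr Q'}"
    "length ys < path_length xs"
proof -
  have xs: "xs \<noteq> []" "distinct xs" "successively (adjacent H) xs" "hd xs = Inr Q" "last xs = Inr Q'"
    using path by (auto simp: path_between_def is_path_def)
  obtain ws where ws: "xs = Inr Q # ws @ [Inr Q']"
  proof -
    obtain zs where zs: "xs = Inr Q # zs" using xs(1,4) by (cases xs) auto
    then have "zs \<noteq> []" using xs(5) \<open>Q \<noteq> Q'\<close> by auto
    then have "zs = butlast zs @ [Inr Q']" using xs(5) zs by (metis append_butlast_last_id last_ConsR)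
    then show ?thesis using zs that by metis
  qed
  obtain ys where ys: "successively (adjacent H) (Inr Q # ys @ [Inr Q'])" "distinct ys"
    "set ys \<subseteq> set ws" "length ys \<le> length ws"
    and chord: "\<And>as z bs. ys = as @ z # bs \<Longrightarrow> adjacent H (Inr Q) z \<Longrightarrow> as = []"
    "\<And>as z bs. ys = as @ z # bs \<Longrightarrow> adjacent H z (Inr Q') \<Longrightarrow> bs = []"
    by (rule ex_chordless_walk[of "adjacent H" "Inr Q" ws "Inr Q'"]) (use xs(3) ws in auto)
  have ne: "ys \<noteq> []" using ys(1) by auto
  have adj: "adjacent H (Inr Q) (hd ys)" "adjacent H (last ys) (Inr Q')"
    "successively (adjacent H) ys"
    using ys(1) ne by (auto simp: successively_Cons successively_append_iff)
  obtain p where p: "hd ys = Inl p" "p \<in> block_nbrs H Q"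
    using adj(1) by (cases "hd ys") auto
  obtain p' where p': "last ys = Inl p'" "p' \<in> block_nbrs H Q'"
    using adj(2) by (cases "last ys") auto
  have "r = p" if r: "r \<in> block_nbrs H Q" "Inl r \<in> set ys" for r
  proof -
    obtain as bs where s: "ys = as @ Inl r # bs" using r(2) split_list by metis
    then have "as = []" using chord(1) r(1) by fastforce
    then show ?thesis using s p(1) by simp
  qed
  moreover have "r = p'" if r: "r \<in> block_nbrs H Q'" "Inl r \<in> set ys" for r
  proof -
    obtain as bs where s: "ys = as @ Inl r # bs" using r(2) split_list by metis
    then have "bs = []" using chord(2) r(1) by fastforce
    then show ?thesis using s p'(1) by simp
  qed
  moreover have "set ys \<subseteq> set xs - {Inr Q, Inr Q'}" using ys(3) xs(2) unfolding ws by auto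
  moreover from this have "Inr Q \<notin> set ys" "Inr Q' \<notin> set ys" by blast+
  moreover have "length ys < path_length xs" using ys(4) by (simp add: ws path_length_def)
  ultimately show ?thesis
    using that[of p p' ys] p p' adj(3) ne ys(2) unfolding route_def by blast
qed

section \<open>Injections with forbidden values\<close>

lemma ex_inj_on_avoiding:
  assumes "finite A" "finite B" "card A \<le> card B" "a \<in> A" "card B \<ge> 2"
  shows "\<exists>f. inj_on f A \<and> f ` A \<subseteq> B \<and> f a \<noteq> b"
proof -
  have "\<not> B \<subseteq> {b}" using assms(5) card_mono[of "{b}" B] by auto
  then obtain s where s: "s \<in> B" "s \<noteq> b" by blast
  have "card (A - {a}) \<le> card (B - {s})" using assms s by (simp add: card_Diff_singleton)
  then obtain g where g: "inj_on g (A - {a})" "g ` (A - {a}) \<subseteq> B - {s}"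
    using assms(1,2) inj_on_iff_card_le[of "A - {a}" "B - {s}"] by auto
  have "inj_on (g(a := s)) A" using g unfolding inj_on_def by auto
  moreover have "(g(a := s)) ` A \<subseteq> B" using g s by auto
  ultimately show ?thesis using s by (intro exI[of _ "g(a := s)"]) auto
qed

lemma ex_derangement:
  assumes "finite A" "card A \<ge> 2"
  shows "\<exists>\<pi>. inj_on \<pi> A \<and> \<pi> ` A \<subseteq> A \<and> (\<forall>a \<in> A. \<pi> a \<noteq> a)"
proof -
  define n where "n = card A"
  obtain e where e: "bij_betw e {0..<n} A"
    using ex_bij_betw_nat_finite[OF assms(1)] n_def by blast
  define i where "i = the_inv_into {0..<n} e"
  have i: "bij_betw i A {0..<n}" "\<And>a. a \<in> A \<Longrightarrow> e (i a) = a"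
    unfolding i_def using e by (auto simp: bij_betw_the_inv_into f_the_inv_into_f_bij_betw)
  \<comment> \<open>The cyclic shift; it has no fixed point because n \<ge> 2.\<close>
  define s where "s j = (if j + 1 = n then 0 else j + 1)" for j
  have n2: "n \<ge> 2" using assms n_def by simp
  have s: "inj_on s {0..<n}" "s ` {0..<n} \<subseteq> {0..<n}" "\<And>j. s j \<noteq> j"
    using n2 by (auto simp: s_def inj_on_def split: if_splits)
  have iA: "i a \<in> {0..<n}" if "a \<in> A" for a using i(1) that by (rule bij_betwE[rule_format])
  have sA: "s (i a) \<in> {0..<n}" if "a \<in> A" for a using s(2) iA[OF that] by blast
  have "inj_on (\<lambda>a. e (s (i a))) A"
  proof (rule inj_onI)
    fix a b assume ab: "a \<in> A" "b \<in> A" "e (s (i a)) = e (s (i b))"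
    then have "s (i a) = s (i b)" using e sA by (meson bij_betw_def inj_onD)
    then have "i a = i b" using s(1) iA ab by (meson inj_onD)
    then show "a = b" using i(2) ab by metis
  qed
  moreover have "e (s (i a)) \<in> A" if "a \<in> A" for a
    using e sA[OF that] by (meson bij_betwE)
  moreover have "e (s (i a)) \<noteq> a" if "a \<in> A" for a
  proof
    assume "e (s (i a)) = a"
    then have "s (i a) = i a" using e sA[OF that] iA[OF that] i(2)[OF that] by (metis bij_betw_def inj_onD)
    then show False using s(3) by blast
  qed
  ultimately show ?thesis by (intro exI[of _ "\<lambda>a. e (s (i a))"]) auto
qed

section \<open>The two-step construction\<close>

locale two_step_method =
  fixes k \<Delta> :: nat
    and H\<^sub>0 :: "('p, 'q) bigraph"
    and T :: "'a design"
    and G :: "'p \<Rightarrow> 'v set"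
    and \<sigma> :: "'q \<Rightarrow> nat \<Rightarrow> 'p"
    and \<phi> :: "'q \<Rightarrow> 'a \<Rightarrow> 'v"
  assumes wf\<^sub>0: "wf_bigraph H\<^sub>0"
    and design: "transversal_design \<Delta> k T"
    and data: "two_step_data \<Delta> k H\<^sub>0 T G \<sigma> \<phi>"
begin

abbreviation H :: "('v, 'q \<times> 'a set) bigraph" where
  "H \<equiv> two_step H\<^sub>0 T G \<phi>"

abbreviation nbrs :: "'q \<Rightarrow> 'p set" where
  "nbrs \<equiv> block_nbrs H\<^sub>0"

abbreviation copy :: "'q \<Rightarrow> ('v, 'q \<times> 'a set) bigraph" where
  "copy \<equiv> design_copy T \<phi>"

text \<open>For a block Q of \<open>H\<^sub>0\<close> and a block U of T this is the neighbourhood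
  of \<open>(Q, U)\<close> in \<open>H\<close>. Arguing with it hides the identifications
  \<open>\<phi> Q\<close>.\<close>

definition pts :: "'q \<Rightarrow> 'a set \<Rightarrow> 'v set" where
  "pts Q U = \<phi> Q ` U"

lemma params: "2 \<le> \<Delta>" "2 \<le> k"
  using design unfolding transversal_design_def by auto

lemma block_subset: "U \<in> dblocks T \<Longrightarrow> U \<subseteq> elems T"
  using design unfolding transversal_design_def by auto

lemma nbrs_node: "p \<in> nbrs Q \<Longrightarrow> p \<in> nodes H\<^sub>0"
  using wf\<^sub>0 unfolding wf_bigraph_def block_nbrs_def by auto

lemma nbrs_block: "p \<in> nbrs Q \<Longrightarrow> Q \<in> blocks H\<^sub>0"
  using wf\<^sub>0 unfolding wf_bigraph_def block_nbrs_def by auto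

lemma card_nbrs: "Q \<in> blocks H\<^sub>0 \<Longrightarrow> finite (nbrs Q) \<and> card (nbrs Q) = \<Delta>"
  using data unfolding two_step_data_def
  by (metis bij_betw_finite bij_betw_same_card card_atLeastAtMost diff_Suc_1 finite_atLeastAtMost)

lemma card_G: "p \<in> nodes H\<^sub>0 \<Longrightarrow> finite (G p) \<and> card (G p) = k"
  using data unfolding two_step_data_def by blast

lemma G_disjoint: "p \<in> nodes H\<^sub>0 \<Longrightarrow> q \<in> nodes H\<^sub>0 \<Longrightarrow> x \<in> G p \<Longrightarrow> x \<in> G q \<Longrightarrow> p = q"
  using data unfolding two_step_data_def disjoint_family_on_def by blast

lemma nbrs_group:
  assumes "Q \<in> blocks H\<^sub>0" "p \<in> nbrs Q"
  obtains i where "i \<in> {1..\<Delta>}" "\<sigma> Q i = p" "bij_betw (\<phi> Q) (group T i) (G p)"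
proof -
  have *: "bij_betw (\<sigma> Q) {1..\<Delta>} (nbrs Q)"
    "\<And>i. i \<in> {1..\<Delta>} \<Longrightarrow> bij_betw (\<phi> Q) (group T i) (G (\<sigma> Q i))"
    using data assms(1) unfolding two_step_data_def by auto
  obtain i where "i \<in> {1..\<Delta>}" "\<sigma> Q i = p"
    using *(1) assms(2) unfolding bij_betw_def by (metis imageE)
  then show ?thesis using that *(2) by blast
qed

lemma group_nbrs:
  assumes "Q \<in> blocks H\<^sub>0" "i \<in> {1..\<Delta>}"
  shows "\<sigma> Q i \<in> nbrs Q" "bij_betw (\<phi> Q) (group T i) (G (\<sigma> Q i))"
proof -
  have "bij_betw (\<sigma> Q) {1..\<Delta>} (nbrs Q)"
    using data assms(1) unfolding two_step_data_def by blast
  then show "\<sigma> Q i \<in> nbrs Q" using assms(2) bij_betwE by metis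
  show "bij_betw (\<phi> Q) (group T i) (G (\<sigma> Q i))"
    using data assms unfolding two_step_data_def by blast
qed

lemma elems_eq: "elems T = (\<Union>i \<in> {1..\<Delta>}. group T i)"
  using design unfolding transversal_design_def by metis

lemma design_join:
  "\<forall>i \<in> {1..\<Delta>}. \<forall>j \<in> {1..\<Delta>}. i \<noteq> j \<longrightarrow>
     (\<forall>x \<in> group T i. \<forall>y \<in> group T j. \<exists>!U. U \<in> dblocks T \<and> x \<in> U \<and> y \<in> U)"
  using design unfolding transversal_design_def by (elim conjE)

lemma elems_group: "a \<in> elems T \<Longrightarrow> \<exists>i \<in> {1..\<Delta>}. a \<in> group T i"
  unfolding elems_eq by blast

lemma group_elems: "i \<in> {1..\<Delta>} \<Longrightarrow> a \<in> group T i \<Longrightarrow> a \<in> elems T"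
  unfolding elems_eq by blast

text \<open>The data give bijectivity group by group only. Elements of different groups are
  separated because \<open>\<sigma> Q\<close> is injective and the sets \<open>G p\<close> are
  disjoint.\<close>

lemma inj_\<phi>:
  assumes "Q \<in> blocks H\<^sub>0"
  shows "inj_on (\<phi> Q) (elems T)"
proof (rule inj_onI)
  fix a b assume ab: "a \<in> elems T" "b \<in> elems T" "\<phi> Q a = \<phi> Q b"
  then obtain i j where ij: "i \<in> {1..\<Delta>}" "a \<in> group T i" "j \<in> {1..\<Delta>}" "b \<in> group T j"
    using elems_group by metis
  have "\<phi> Q a \<in> G (\<sigma> Q i)" "\<phi> Q a \<in> G (\<sigma> Q j)"
    using group_nbrs(2)[OF assms] ij ab(3) by (metis bij_betwE)+
  then have "\<sigma> Q i = \<sigma> Q j"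
    using G_disjoint nbrs_node group_nbrs(1)[OF assms] ij by meson
  moreover have "inj_on (\<sigma> Q) {1..\<Delta>}"
    using data assms unfolding two_step_data_def bij_betw_def by auto
  ultimately have "i = j" using ij by (meson inj_onD)
  then show "a = b" using group_nbrs(2)[OF assms ij(1)] ij ab(3) by (meson bij_betw_def inj_onD)
qed

lemma pts_cover:
  assumes "Q \<in> blocks H\<^sub>0" "U \<in> dblocks T" "x \<in> pts Q U"
  obtains p where "p \<in> nbrs Q" "x \<in> G p"
proof -
  obtain a where a: "a \<in> U" "x = \<phi> Q a" using assms(3) by (auto simp: pts_def)
  then have "a \<in> elems T" using block_subset[OF assms(2)] by blast
  then obtain i where i: "i \<in> {1..\<Delta>}" "a \<in> group T i" using elems_group by blast
  then have "x \<in> G (\<sigma> Q i)" using group_nbrs(2)[OF assms(1)] a(2) by (metis bij_betwE)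
  then show ?thesis using that group_nbrs(1)[OF assms(1) i(1)] by blast
qed

lemma pts_Int_G:
  assumes "Q \<in> blocks H\<^sub>0" "U \<in> dblocks T" "p \<in> nbrs Q"
  obtains x where "pts Q U \<inter> G p = {x}"
proof -
  obtain i where i: "i \<in> {1..\<Delta>}" "bij_betw (\<phi> Q) (group T i) (G p)"
    using nbrs_group assms by metis
  have "card (U \<inter> group T i) = 1" using design assms(2) i(1) unfolding transversal_design_def by blast
  then obtain a where a: "U \<inter> group T i = {a}" by (auto simp: card_1_singleton_iff)
  have "pts Q U \<inter> G p = \<phi> Q ` U \<inter> \<phi> Q ` group T i"
    using i(2) by (simp add: pts_def bij_betw_def)
  also have "\<dots> = \<phi> Q ` (U \<inter> group T i)"
    using inj_on_image_Int[OF inj_\<phi>[OF assms(1)], of U "group T i"] block_subset[OF assms(2)]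
      group_elems[OF i(1)] by blast
  finally show ?thesis using a that by auto
qed

lemma card_pts:
  assumes "Q \<in> blocks H\<^sub>0" "U \<in> dblocks T"
  shows "finite (pts Q U) \<and> card (pts Q U) = \<Delta>"
proof -
  have "card U = \<Delta>" using design assms(2) unfolding transversal_design_def by blast
  moreover have "inj_on (\<phi> Q) U"
    using inj_\<phi>[OF assms(1)] block_subset[OF assms(2)] inj_on_subset by blast
  ultimately show ?thesis
    unfolding pts_def using params card_image card.infinite by (metis finite_imageI not_numeral_le_zero)
qed

lemma join_ex:
  assumes "p \<in> nbrs Q" "q \<in> nbrs Q" "p \<noteq> q" "x \<in> G p" "y \<in> G q"
  obtains U where "U \<in> dblocks T" "x \<in> pts Q U" "y \<in> pts Q U"
proof -
  have Q: "Q \<in> blocks H\<^sub>0" using assms(1) nbrs_block by blast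
  obtain i where i: "i \<in> {1..\<Delta>}" "\<sigma> Q i = p" "bij_betw (\<phi> Q) (group T i) (G p)"
    using nbrs_group[OF Q assms(1)] by blast
  obtain j where j: "j \<in> {1..\<Delta>}" "\<sigma> Q j = q" "bij_betw (\<phi> Q) (group T j) (G q)"
    using nbrs_group[OF Q assms(2)] by blast
  obtain a where a: "a \<in> group T i" "x = \<phi> Q a" using i(3) assms(4) by (metis bij_betw_def imageE)
  obtain b where b: "b \<in> group T j" "y = \<phi> Q b" using j(3) assms(5) by (metis bij_betw_def imageE)
  have "i \<noteq> j" using i j assms(3) by blast
  then have "\<exists>!U. U \<in> dblocks T \<and> a \<in> U \<and> b \<in> U"
    using design_join i(1) j(1) a(1) b(1) by simp
  then show ?thesis using that a b unfolding pts_def by blast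
qed

lemma pts_same_group:
  assumes "U \<in> dblocks T" "p \<in> nbrs Q" "x \<in> G p" "y \<in> G p" "x \<in> pts Q U" "y \<in> pts Q U"
  shows "x = y"
proof -
  obtain z where "pts Q U \<inter> G p = {z}" using pts_Int_G[OF nbrs_block] assms by metis
  then show ?thesis using assms by (metis IntI singletonD)
qed

text \<open>Two different points of a block lie in different groups, and the design joins such a
  pair only once. Used mostly in the form: a block of the copy sharing two points with V is
  V.\<close>

lemma join_unique:
  assumes Q: "Q \<in> blocks H\<^sub>0" and U: "U \<in> dblocks T" "U' \<in> dblocks T"
    and "x \<noteq> y" "x \<in> pts Q U" "y \<in> pts Q U" "x \<in> pts Q U'" "y \<in> pts Q U'"
  shows "U = U'"
proof -
  obtain a where a: "a \<in> U" "x = \<phi> Q a" using assms(5) by (auto simp: pts_def)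
  obtain b where b: "b \<in> U" "y = \<phi> Q b" using assms(6) by (auto simp: pts_def)
  have e: "a \<in> elems T" "b \<in> elems T" "U' \<subseteq> elems T" using block_subset U a b by blast+
  have ab: "a \<in> U'" "b \<in> U'"
    using assms(7,8) a(2) b(2) e inj_\<phi>[OF Q] by (auto simp: pts_def inj_on_image_mem_iff)
  obtain i j where ij: "i \<in> {1..\<Delta>}" "a \<in> group T i" "j \<in> {1..\<Delta>}" "b \<in> group T j"
    using elems_group e by metis
  have "i \<noteq> j"
  proof
    assume "i = j"
    then have "x \<in> G (\<sigma> Q i)" "y \<in> G (\<sigma> Q i)"
      using group_nbrs(2)[OF Q ij(1)] ij a(2) b(2) by (auto simp: bij_betw_def)
    then show False
      using pts_same_group[OF U(1) group_nbrs(1)[OF Q ij(1)]] assms(4-6) by blast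
  qed
  then have "\<exists>!U. U \<in> dblocks T \<and> a \<in> U \<and> b \<in> U"
    using design_join ij by simp
  then show ?thesis using U a(1) b(1) ab by blast
qed

text \<open>Take a point y of \<open>G p\<close> off a block V, and another group
  \<open>G r\<close>. The blocks joining y to the \<Delta> - 1 points of V outside
  \<open>G p\<close> are distinct, as two equal ones would coincide with V. Any two of them meet
  only in y, so they cut \<open>G r\<close> in \<Delta> - 1 different points.\<close>

lemma \<Delta>_le:
  assumes Q: "Q \<in> blocks H\<^sub>0"
  shows "\<Delta> \<le> k + 1"
proof -
  have "card (dblocks T) \<noteq> 0" using design params unfolding transversal_design_def by auto
  then obtain V where V: "V \<in> dblocks T" by (metis card.empty equals0I)
  have nb: "finite (nbrs Q)" "card (nbrs Q) = \<Delta>" using card_nbrs[OF Q] by auto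
  then obtain p where p: "p \<in> nbrs Q" using params by fastforce
  have "\<not> nbrs Q \<subseteq> {p}" using nb params card_mono[of "{p}" "nbrs Q"] by auto
  then obtain r where r: "r \<in> nbrs Q" "r \<noteq> p" by blast
  obtain v where v: "pts Q V \<inter> G p = {v}" using pts_Int_G[OF Q V p] .
  have "\<not> G p \<subseteq> {v}" using card_G[OF nbrs_node[OF p]] params card_mono[of "{v}" "G p"] by auto
  then obtain y where y: "y \<in> G p" "y \<notin> pts Q V" using v by blast
  have "\<exists>U v z. U \<in> dblocks T \<and> y \<in> pts Q U \<and> v \<in> pts Q U \<and> v \<in> pts Q V \<and> v \<in> G q \<and> z \<in> pts Q U \<and> z \<in> G r"
    if q: "q \<in> nbrs Q - {p}" for q
  proof -
    obtain v where v: "pts Q V \<inter> G q = {v}" using pts_Int_G[OF Q V, of q] q by blast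
    obtain U where U: "U \<in> dblocks T" "y \<in> pts Q U" "v \<in> pts Q U"
      using join_ex[OF p _ _ y(1), of q v] q v by blast
    obtain z where "pts Q U \<inter> G r = {z}" using pts_Int_G[OF Q U(1) r(1)] .
    then show ?thesis using U v by blast
  qed
  then obtain U v z where *: "\<And>q. q \<in> nbrs Q - {p} \<Longrightarrow> U q \<in> dblocks T \<and> y \<in> pts Q (U q) \<and>
    v q \<in> pts Q (U q) \<and> v q \<in> pts Q V \<and> v q \<in> G q \<and> z q \<in> pts Q (U q) \<and> z q \<in> G r" by metis
  have "inj_on z (nbrs Q - {p})"
  proof (rule inj_onI, rule ccontr)
    fix a b assume ab: "a \<in> nbrs Q - {p}" "b \<in> nbrs Q - {p}" "z a = z b" "a \<noteq> b"
    have "y \<noteq> z a" using *[OF ab(1)] y(1) r G_disjoint nbrs_node p by metis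
    then have "U a = U b" using join_unique[OF Q, of "U a" "U b" y "z a"] *[OF ab(1)] *[OF ab(2)] ab(3) by metis
    moreover have "v a \<noteq> v b" using *[OF ab(1)] *[OF ab(2)] ab G_disjoint nbrs_node by (metis DiffD1)
    ultimately have "U a = V" using join_unique[OF Q, of "U a" V "v a" "v b"] *[OF ab(1)] *[OF ab(2)] V by metis
    then show False using *[OF ab(1)] y(2) by blast
  qed
  moreover have "z ` (nbrs Q - {p}) \<subseteq> G r" using * by blast
  ultimately have "card (nbrs Q - {p}) \<le> card (G r)"
    using card_inj_on_le card_G[OF nbrs_node[OF r(1)]] by blast
  then show ?thesis using nb p card_G[OF nbrs_node[OF r(1)]] by (simp add: card_Diff_singleton)
qed

lemma nbrs_copy: "Q \<in> blocks H\<^sub>0 \<Longrightarrow> block_nbrs (copy Q) (R, U) = (if R = Q \<and> U \<in> dblocks T then pts Q U else {})"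
  using block_subset unfolding block_nbrs_def design_copy_def design_graph_def pts_def by auto

lemma nbrs_H: "block_nbrs H (Q, U) = (if Q \<in> blocks H\<^sub>0 \<and> U \<in> dblocks T then pts Q U else {})"
  using block_subset
  unfolding block_nbrs_def two_step_def design_copy_def design_graph_def pts_def by auto

lemma blocks_H: "(Q, U) \<in> blocks H \<longleftrightarrow> Q \<in> blocks H\<^sub>0 \<and> U \<in> dblocks T"
  unfolding two_step_def design_copy_def design_graph_def by auto

lemma wf_copy: "wf_bigraph (copy Q)"
  unfolding wf_bigraph_def design_copy_def design_graph_def by auto

lemma wf_H: "wf_bigraph H"
  unfolding wf_bigraph_def
proof
  fix e assume "e \<in> edges H"
  then obtain x Q U where e: "e = (x, (Q, U))" "x \<in> block_nbrs H (Q, U)"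
    unfolding block_nbrs_def by (cases e) auto
  then have *: "Q \<in> blocks H\<^sub>0" "U \<in> dblocks T" "x \<in> pts Q U" by (auto simp: nbrs_H split: if_splits)
  then obtain p where "p \<in> nbrs Q" "x \<in> G p" using pts_cover by blast
  then have "x \<in> nodes H" using nbrs_node by (auto simp: two_step_def)
  then show "e \<in> nodes H \<times> blocks H" using e * by (auto simp: blocks_H)
qed

lemma copy_subgraph:
  assumes "Q \<in> blocks H\<^sub>0"
  shows "verts (copy Q) \<subseteq> verts H" "edges (copy Q) \<subseteq> edges H"
proof -
  have "\<phi> Q a \<in> nodes H" if a: "a \<in> elems T" for a
  proof -
    obtain i where i: "i \<in> {1..\<Delta>}" "a \<in> group T i" using elems_group a by blast
    then have "\<phi> Q a \<in> G (\<sigma> Q i)" using group_nbrs(2)[OF assms] by (metis bij_betwE)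
    then show ?thesis using nbrs_node[OF group_nbrs(1)[OF assms i(1)]] by (auto simp: two_step_def)
  qed
  then have "nodes (copy Q) \<subseteq> nodes H" by (auto simp: design_copy_def design_graph_def)
  moreover have "blocks (copy Q) \<subseteq> blocks H" using assms by (auto simp: two_step_def)
  ultimately show "verts (copy Q) \<subseteq> verts H" unfolding verts_def by blast
  show "edges (copy Q) \<subseteq> edges H" using assms by (auto simp: two_step_def)
qed

section \<open>Two blocks of the same copy\<close>

lemma disjoint_paths_same_copy:
  assumes Q: "Q \<in> blocks H\<^sub>0" and V: "V \<in> dblocks T" "V' \<in> dblocks T" "V \<noteq> V'"
  shows "\<exists>P. disjoint_paths (copy Q) (Inr (Q, V)) (Inr (Q, V')) \<Delta> 6 P"
proof -
  have nb: "finite (nbrs Q)" "card (nbrs Q) = \<Delta>" using card_nbrs[OF Q] by auto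
  have "\<exists>x. pts Q V \<inter> G p = {x}" "\<exists>x. pts Q V' \<inter> G p = {x}" if "p \<in> nbrs Q" for p
    using pts_Int_G[OF Q] V that by metis+
  then obtain v v' where v: "\<And>p. p \<in> nbrs Q \<Longrightarrow> pts Q V \<inter> G p = {v p}"
    "\<And>p. p \<in> nbrs Q \<Longrightarrow> pts Q V' \<inter> G p = {v' p}" by metis
  have vD: "v p \<in> pts Q V" "v p \<in> G p" "v' p \<in> pts Q V'" "v' p \<in> G p" if "p \<in> nbrs Q" for p
    using v[OF that] by blast+
  have veq: "p = q" if "p \<in> nbrs Q" "q \<in> nbrs Q" "x \<in> G p" "x \<in> G q" for p q x
    using that G_disjoint nbrs_node by meson
  have mem: "v p \<in> pts Q V' \<longleftrightarrow> v p = v' p" "v' p \<in> pts Q V \<longleftrightarrow> v p = v' p" if "p \<in> nbrs Q" for p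
    using v[OF that] vD[OF that] by (metis IntI singletonD)+
  define D where "D = {p \<in> nbrs Q. v p \<noteq> v' p}"
  \<comment> \<open>Two points common to V and V' would force V = V', so at most one group lies
    outside \<open>D\<close>.\<close>
  have D1: "p = q" if "p \<in> nbrs Q - D" "q \<in> nbrs Q - D" for p q
  proof (rule ccontr)
    assume "p \<noteq> q"
    then have "v p \<noteq> v q" using vD veq that by (metis DiffD1)
    moreover have "v p \<in> pts Q V'" "v q \<in> pts Q V'" using that vD[of p] vD[of q] D_def by auto
    ultimately show False using join_unique[OF Q V(1,2), of "v p" "v q"] vD that V(3) by blast
  qed
  have DN: "D \<subseteq> nbrs Q" "finite D" using nb by (auto simp: D_def)
  have "card (nbrs Q - D) \<le> 1"
    using D1 by (metis card_le_Suc0_iff_eq One_nat_def finite_Diff nb(1))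
  then have cD: "card D + 1 \<ge> \<Delta>" using nb DN by (simp add: card_Diff_subset)
  have "\<exists>W. \<forall>p \<in> nbrs Q. successively (adjacent (copy Q)) (Inr (Q, V) # W p @ [Inr (Q, V')]) \<and>
      length (W p) < 6 \<and> Inr (Q, V) \<notin> set (W p) \<and> Inr (Q, V') \<notin> set (W p) \<and>
      (\<forall>q \<in> nbrs Q. p \<noteq> q \<longrightarrow> set (W p) \<inter> set (W q) = {})"
  proof (cases "card D \<ge> 2")
    case True
    \<comment> \<open>No block joins two different points of one group, so \<open>v p\<close> must
      be paired with a point of V' in another group: hence no fixed points.\<close>
    then obtain \<pi> where \<pi>: "inj_on \<pi> D" "\<pi> ` D \<subseteq> D" "\<And>p. p \<in> D \<Longrightarrow> \<pi> p \<noteq> p"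
      using ex_derangement[OF DN(2)] by blast
    have "\<exists>U. U \<in> dblocks T \<and> v p \<in> pts Q U \<and> v' (\<pi> p) \<in> pts Q U" if "p \<in> D" for p
    proof -
      have "p \<in> nbrs Q" "\<pi> p \<in> nbrs Q" "p \<noteq> \<pi> p" using that \<pi>(2) \<pi>(3)[OF that] DN by auto
      then show ?thesis using join_ex[of p Q "\<pi> p" "v p" "v' (\<pi> p)"] vD by metis
    qed
    then obtain U where U: "\<And>p. p \<in> D \<Longrightarrow> U p \<in> dblocks T" "\<And>p. p \<in> D \<Longrightarrow> v p \<in> pts Q (U p)"
      "\<And>p. p \<in> D \<Longrightarrow> v' (\<pi> p) \<in> pts Q (U p)" by metis
    define W where "W p = (if p \<in> D then [Inl (v p), Inr (Q, U p), Inl (v' (\<pi> p))] else [Inl (v p)])" for p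
    have \<pi>D: "\<pi> p \<in> D" "\<pi> p \<in> nbrs Q" "p \<in> nbrs Q" if "p \<in> D" for p using that \<pi> DN by auto
    \<comment> \<open>Both \<open>p\<close> and \<open>\<pi> p\<close> lie in \<open>D\<close>, so
      \<open>v p\<close> is off V' and \<open>v' (\<pi> p)\<close> is off V.\<close>
    have UV: "U p \<noteq> V" "U p \<noteq> V'" if "p \<in> D" for p
      using U[OF that] \<pi>D[OF that] that mem D_def by auto
    have neq: "v p \<noteq> v q" "v' p \<noteq> v' q" "v p \<noteq> v' q" if "p \<in> nbrs Q" "q \<in> nbrs Q" "p \<noteq> q" for p q
      using that vD veq by metis+
    have Uinj: "U p \<noteq> U q" if pq: "p \<in> D" "q \<in> D" "p \<noteq> q" for p q
    proof
      assume "U p = U q"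
      then have "U p = V"
        using join_unique[OF Q U(1)[OF pq(1)] V(1) neq(1)[of p q]] pq U DN vD by (metis subsetD)
      then show False using UV pq by blast
    qed
    have "set (W p) \<inter> set (W q) = {}" if pq: "p \<in> nbrs Q" "q \<in> nbrs Q" "p \<noteq> q" for p q
    proof -
      have a: "v p \<noteq> v' (\<pi> q)" if "p \<in> nbrs Q" "q \<in> D" for p q
        using neq(3)[of p "\<pi> q"] \<pi>D(1,2)[of q] that D_def by (cases "p = \<pi> q") auto
      have b: "v' (\<pi> p) \<noteq> v' (\<pi> q)" if "p \<in> D" "q \<in> D"
        using neq(2)[of "\<pi> p" "\<pi> q"] \<pi>D \<pi>(1) that pq(3) by (meson inj_onD)
      show ?thesis
        using neq(1)[OF pq] a[of p q] a[of q p] b Uinj[of p q] pq unfolding W_def by auto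
    qed
    moreover have "successively (adjacent (copy Q)) (Inr (Q, V) # W p @ [Inr (Q, V')])" if "p \<in> nbrs Q" for p
      using that vD[OF that] mem[OF that] U[of p] \<pi>D[of p] vD[of "\<pi> p"] V
      by (auto simp: W_def nbrs_copy[OF Q] D_def)
    moreover have "length (W p) < 6 \<and> Inr (Q, V) \<notin> set (W p) \<and> Inr (Q, V') \<notin> set (W p)" for p
      using UV[of p] by (auto simp: W_def)
    ultimately show ?thesis by blast
  next
    case False
    \<comment> \<open>Then \<open>\<Delta> = 2\<close> and the blocks share a point \<open>v c\<close>; the detour uses another point of its group.\<close>
    then have cD1: "card D = 1" "\<Delta> = 2" using cD params by auto
    then obtain e where e: "D = {e}" by (auto simp: card_1_singleton_iff)
    have eN: "e \<in> nbrs Q" using e DN by auto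
    have "card (nbrs Q - {e}) = 1" using nb cD1 eN by (simp add: card_Diff_singleton)
    then obtain c where c: "nbrs Q - {e} = {c}" by (auto simp: card_1_singleton_iff)
    then have cN: "c \<in> nbrs Q" "c \<noteq> e" "nbrs Q = {c, e}" using eN by auto
    have vc: "v c = v' c" using cN e D_def by auto
    have "\<not> G c \<subseteq> {v c}" using card_G[OF nbrs_node[OF cN(1)]] params card_mono[of "{v c}" "G c"] by auto
    then obtain x where x: "x \<in> G c" "x \<noteq> v c" by blast
    obtain U where U: "U \<in> dblocks T" "v e \<in> pts Q U" "x \<in> pts Q U"
      using join_ex[OF eN cN(1) _ _ x(1), of "v e"] vD[OF eN] cN by metis
    obtain U' where U': "U' \<in> dblocks T" "v' e \<in> pts Q U'" "x \<in> pts Q U'"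
      using join_ex[OF eN cN(1) _ _ x(1), of "v' e"] vD[OF eN] cN by metis
    have xV: "x \<notin> pts Q V" "x \<notin> pts Q V'" using v[OF cN(1)] x vc by auto
    \<comment> \<open>\<open>v e\<close> and \<open>v' e\<close> lie in one group, so one block
      cannot join them. The five inner vertices of this detour are the source of the bound
      6.\<close>
    define W where "W p = (if p = c then [Inl (v c)] else
      [Inl (v e), Inr (Q, U), Inl x, Inr (Q, U'), Inl (v' e)])" for p
    have neq: "v c \<noteq> v e" "v c \<noteq> v' e" using vD[OF eN] vD[OF cN(1)] veq[OF cN(1) eN] cN(2) by metis+
    have "U \<noteq> V" "U' \<noteq> V" "U \<noteq> V'" "U' \<noteq> V'" using U U' xV by auto
    then show ?thesis
      using U U' V vD[OF eN] vD[OF cN(1)] vc neq x cN(2)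
      by (intro exI[of _ W]) (auto simp: W_def nbrs_copy[OF Q] cN(3))
  qed
  then obtain W where "\<forall>p \<in> nbrs Q. successively (adjacent (copy Q)) (Inr (Q, V) # W p @ [Inr (Q, V')]) \<and>
      length (W p) < 6 \<and> Inr (Q, V) \<notin> set (W p) \<and> Inr (Q, V') \<notin> set (W p) \<and>
      (\<forall>q \<in> nbrs Q. p \<noteq> q \<longrightarrow> set (W p) \<inter> set (W q) = {})" by blast
  then have "\<exists>P. disjoint_paths (copy Q) (Inr (Q, V)) (Inr (Q, V')) (card (nbrs Q)) 6 P"
    using V(3) by (intro disjoint_pathsI_walks[OF wf_copy nb(1), of _ _ _ W]) auto
  then show ?thesis using nb by simp
qed

section \<open>Blocks of different copies\<close>

text \<open>The preimage of S under the projection from H to \<open>H\<^sub>0\<close> that sends a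
  point of \<open>G q\<close> to q and \<open>(R, U)\<close> to R. Disjointness in
  \<open>H\<^sub>0\<close> thus lifts to H.\<close>

definition over :: "('p + 'q) set \<Rightarrow> ('v + 'q \<times> 'a set) set" where
  "over S = {Inl z | z. \<exists>q \<in> nodes H\<^sub>0. Inl q \<in> S \<and> z \<in> G q} \<union> {Inr (R, U) | R U. Inr R \<in> S}"

lemma Inl_over: "q \<in> nodes H\<^sub>0 \<Longrightarrow> z \<in> G q \<Longrightarrow> Inl z \<in> over S \<longleftrightarrow> Inl q \<in> S"
  unfolding over_def using G_disjoint by auto

lemma Inr_over: "Inr (R, U) \<in> over S \<longleftrightarrow> Inr R \<in> S"
  unfolding over_def by auto

lemma over_disjoint: "S \<inter> S' = {} \<Longrightarrow> over S \<inter> over S' = {}"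
  unfolding over_def using G_disjoint by fastforce

lemma over_mono: "S \<subseteq> S' \<Longrightarrow> over S \<subseteq> over S'"
  unfolding over_def by blast

text \<open>With S the vertex set of a route, this keeps the points of V used by a fan off all
  links: the route meets the neighbourhood of Q only in p.\<close>

lemma Inl_notin_over:
  assumes "Q \<in> blocks H\<^sub>0" "V \<in> dblocks T" "a \<in> pts Q V" "\<forall>r \<in> nbrs Q. Inl r \<in> S \<longrightarrow> r = p"
    and "a \<notin> G p"
  shows "Inl a \<notin> over S"
proof -
  obtain r where r: "r \<in> nbrs Q" "a \<in> G r" using pts_cover[OF assms(1-3)] .
  then have "Inl r \<notin> S" using assms(4,5) by blast
  then show ?thesis using Inl_over[OF nbrs_node[OF r(1)] r(2)] by blast
qed

text \<open>Equality of lengths lets the length bound of the route carry over. The last condition on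
  a single walk, that it meets the final group only in its end, is needed when one walk of the link
  is used alone and a fan passes through other points of that group.\<close>

definition link :: "'p \<Rightarrow> 'p \<Rightarrow> ('p + 'q) list \<Rightarrow> ('v \<Rightarrow> ('v + 'q \<times> 'a set) list) \<Rightarrow> ('v \<Rightarrow> 'v) \<Rightarrow> bool"
  where "link p p' ys W h \<longleftrightarrow>
    (\<forall>x \<in> G p. successively (adjacent H) (W x) \<and> W x \<noteq> [] \<and> hd (W x) = Inl x \<and>
       last (W x) = Inl (h x) \<and> h x \<in> G p' \<and> length (W x) = length ys \<and>
       set (W x) \<subseteq> over (set ys) \<and> (\<forall>z \<in> G p'. Inl z \<in> set (W x) \<longrightarrow> z = h x)) \<and>
    (\<forall>x \<in> G p. \<forall>y \<in> G p. x \<noteq> y \<longrightarrow> set (W x) \<inter> set (W y) = {})"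

text \<open>Induction on \<open>ys\<close>, removing the first node p and the block R after it. Any
  bijection from \<open>G p\<close> to the group of the next node will do: x and its image are
  joined by a block above R, and these blocks differ because a block contains only one point of
  \<open>G p\<close>.\<close>

lemma ex_link:
  assumes "successively (adjacent H\<^sub>0) ys" "distinct ys" "ys \<noteq> []" "hd ys = Inl p" "last ys = Inl p'"
    and "p \<in> nodes H\<^sub>0"
  shows "p' \<in> nodes H\<^sub>0 \<and> (\<exists>W h. link p p' ys W h)"
  using assms
proof (induction ys arbitrary: p rule: length_induct)
  case (1 ys)
  show ?case
  proof (cases "tl ys")
    case Nil
    then have ys: "ys = [Inl p]" and [simp]: "p' = p" using "1.prems" by (cases ys; auto)+
    have "link p p' ys (\<lambda>x. [Inl x]) (\<lambda>x. x)"
      using "1.prems"(6) unfolding link_def ys by (auto simp: Inl_over)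
    then show ?thesis using "1.prems"(6) by auto
  next
    case (Cons b bs)
    then have ys0: "ys = Inl p # b # bs" using "1.prems"(3,4) by (cases ys) auto
    then obtain R where b: "b = Inr R" using "1.prems"(1) by (cases b) auto
    have "bs \<noteq> []" using "1.prems"(5) ys0 b by auto
    then obtain c rest where bs: "bs = c # rest" by (cases bs) auto
    then obtain q where c: "c = Inl q" using "1.prems"(1) ys0 b by (cases c) auto
    define zs where "zs = Inl q # rest"
    have ys: "ys = Inl p # Inr R # zs" using ys0 b bs c zs_def by simp
    have pq: "p \<in> nbrs R" "q \<in> nbrs R" "p \<noteq> q" "Inl p \<notin> set zs" "Inr R \<notin> set zs"
      using "1.prems"(1,2) unfolding ys zs_def by auto
    have "p' \<in> nodes H\<^sub>0 \<and> (\<exists>W h. link q p' zs W h)"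
      using "1.prems" "1.IH"[rule_format, of zs q] nbrs_node[OF pq(2)] unfolding ys zs_def
      by auto
    then obtain W h where p': "p' \<in> nodes H\<^sub>0" and link: "link q p' zs W h" by blast
    have W: "successively (adjacent H) (W x)" "W x \<noteq> []" "hd (W x) = Inl x" "last (W x) = Inl (h x)"
      "h x \<in> G p'" "length (W x) = length zs" "set (W x) \<subseteq> over (set zs)"
      "\<And>z. z \<in> G p' \<Longrightarrow> Inl z \<in> set (W x) \<Longrightarrow> z = h x"
      "\<And>y. y \<in> G q \<Longrightarrow> x \<noteq> y \<Longrightarrow> set (W x) \<inter> set (W y) = {}" if "x \<in> G q" for x
      using link that unfolding link_def by auto
    obtain f where f: "bij_betw f (G p) (G q)"
      using finite_same_card_bij card_G nbrs_node pq by metis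
    have fG: "f x \<in> G q" if "x \<in> G p" for x using f that by (metis bij_betwE)
    have "\<exists>U. U \<in> dblocks T \<and> x \<in> pts R U \<and> f x \<in> pts R U" if x: "x \<in> G p" for x
      using join_ex[OF pq(1-3) x fG[OF x]] by metis
    then obtain U where U: "\<And>x. x \<in> G p \<Longrightarrow> U x \<in> dblocks T" "\<And>x. x \<in> G p \<Longrightarrow> x \<in> pts R (U x)"
      "\<And>x. x \<in> G p \<Longrightarrow> f x \<in> pts R (U x)" by metis
    define W' where "W' x = Inl x # Inr (R, U x) # W (f x)" for x
    have R: "R \<in> blocks H\<^sub>0" using nbrs_block pq by blast
    have "Inl p' \<in> set zs" using "1.prems"(5) last_in_set[of zs] unfolding ys zs_def by auto
    then have "p' \<noteq> p" using pq by auto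
    have out: "Inl x \<notin> set (W (f y))" "Inr (R, U x) \<notin> set (W (f y))" if "x \<in> G p" "y \<in> G p" for x y
      using W(7)[OF fG[OF that(2)]] Inl_over[OF nbrs_node[OF pq(1)] that(1), of "set zs"]
        Inr_over[of R "U x" "set zs"] pq by blast+
    have "link p p' ys W' (\<lambda>x. h (f x))"
      unfolding link_def
    proof (intro conjI ballI impI)
      fix x assume x: "x \<in> G p"
      note Wx = W[OF fG[OF x]]
      show "successively (adjacent H) (W' x)"
        using Wx(1-3) U[OF x] R by (auto simp: W'_def nbrs_H successively_Cons)
      show "W' x \<noteq> []" "hd (W' x) = Inl x" "last (W' x) = Inl (h (f x))" "h (f x) \<in> G p'"
        "length (W' x) = length ys"
        using Wx by (auto simp: W'_def ys)
      have "Inl x \<in> over (set ys)" "Inr (R, U x) \<in> over (set ys)"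
        using Inl_over[OF nbrs_node[OF pq(1)] x] Inr_over unfolding ys by auto
      moreover have "set (W (f x)) \<subseteq> over (set ys)"
        using Wx(7) over_mono[of "set zs" "set ys"] unfolding ys by auto
      ultimately show "set (W' x) \<subseteq> over (set ys)" by (simp add: W'_def)
      fix z assume z: "z \<in> G p'" "Inl z \<in> set (W' x)"
      have "z \<noteq> x" using G_disjoint[OF nbrs_node[OF pq(1)] p' x] z(1) \<open>p' \<noteq> p\<close> by blast
      then show "z = h (f x)" using z Wx(8) by (auto simp: W'_def)
    next
      fix x y assume xy: "x \<in> G p" "y \<in> G p" "x \<noteq> y"
      have "f x \<noteq> f y" using f xy by (metis bij_betw_def inj_onD)
      then have "set (W (f x)) \<inter> set (W (f y)) = {}" using W(9) fG xy by blast
      moreover have "U x \<noteq> U y"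
        using pts_same_group[OF U(1) pq(1)] U(2) xy by metis
      ultimately show "set (W' x) \<inter> set (W' y) = {}"
        using out[OF xy(1,2)] out[OF xy(2,1)] xy(3) by (auto simp: W'_def)
    qed
    then show ?thesis using p' by blast
  qed
qed

text \<open>Disjoint walks have different ends, and both groups have k points. Surjectivity permits
  choosing the link that ends in a prescribed point.\<close>

lemma link_bij:
  assumes "link p p' ys W h" "p \<in> nodes H\<^sub>0" "p' \<in> nodes H\<^sub>0"
  shows "bij_betw h (G p) (G p')"
proof -
  have *: "W x \<noteq> []" "last (W x) = Inl (h x)" "h x \<in> G p'" if "x \<in> G p" for x
    using assms(1) that unfolding link_def by auto
  have "inj_on h (G p)"
  proof (rule inj_onI, rule ccontr)
    fix x y assume xy: "x \<in> G p" "y \<in> G p" "h x = h y" "x \<noteq> y"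
    then have "set (W x) \<inter> set (W y) = {}" using assms(1) unfolding link_def by blast
    moreover have "Inl (h x) \<in> set (W x)" "Inl (h y) \<in> set (W y)"
      using *[OF xy(1)] *[OF xy(2)] last_in_set by metis+
    ultimately show False using xy(3) by auto
  qed
  moreover have "h ` G p \<subseteq> G p'" using * by blast
  ultimately show ?thesis
    unfolding bij_betw_def using card_G[OF assms(2)] card_G[OF assms(3)]
    by (metis card_image card_subset_eq)
qed

section \<open>Fans at the two end blocks\<close>

text \<open>
  The path of the fan to \<open>h x\<close> leaves \<open>(Q, V)\<close> through its point \<open>f x\<close> and, unless \<open>h x = f x\<close>,
  continues through a block \<open>U\<close> joining \<open>f x\<close> to \<open>h x\<close>. These blocks are automatically distinct for
  distinct \<open>x\<close>: a coinciding one would share two points with \<open>V\<close>, hence equal \<open>V\<close>.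
\<close>

definition fan :: "'q \<Rightarrow> 'a set \<Rightarrow> 'x set \<Rightarrow> ('x \<Rightarrow> 'v) \<Rightarrow> ('x \<Rightarrow> 'v) \<Rightarrow> bool" where
  "fan Q V X h f \<longleftrightarrow> inj_on f X \<and> f ` X \<subseteq> pts Q V \<and>
     (\<forall>x \<in> X. if h x \<in> pts Q V then f x = h x
        else \<exists>U \<in> dblocks T. f x \<in> pts Q U \<and> h x \<in> pts Q U)"

text \<open>A value \<open>h y\<close> that lies in V is taken by y itself, so injectivity of
  \<open>f\<close> keeps it from any other x. Hence the detours of a fan never run through the end
  of another link.\<close>

lemma fan_new:
  assumes "fan Q V X h f" "x \<in> X" "h x \<notin> pts Q V" "y \<in> X"
  shows "f x \<noteq> h y"
proof
  assume eq: "f x = h y"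
  have "inj_on f X" and "f x \<in> pts Q V" and *: "h y \<in> pts Q V \<longrightarrow> f y = h y"
    using assms(1,2,4) unfolding fan_def by auto
  then have "f y = f x" using eq by simp
  then have "x = y" using inj_onD[OF \<open>inj_on f X\<close>] assms(2,4) by metis
  then show False using eq \<open>f x \<in> pts Q V\<close> assms(3) by simp
qed

lemma fan_blocks:
  assumes Q: "Q \<in> blocks H\<^sub>0" and V: "V \<in> dblocks T" and fan: "fan Q V X h f"
  obtains A where "\<And>x. x \<in> X \<Longrightarrow> h x \<notin> pts Q V \<Longrightarrow>
      A x \<in> dblocks T \<and> f x \<in> pts Q (A x) \<and> h x \<in> pts Q (A x) \<and> A x \<noteq> V"
    "\<And>x y. x \<in> X \<Longrightarrow> y \<in> X \<Longrightarrow> h x \<notin> pts Q V \<Longrightarrow> h y \<notin> pts Q V \<Longrightarrow> x \<noteq> y \<Longrightarrow> A x \<noteq> A y"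
proof -
  have "\<exists>U. U \<in> dblocks T \<and> f x \<in> pts Q U \<and> h x \<in> pts Q U" if "x \<in> X" "h x \<notin> pts Q V" for x
    using fan that unfolding fan_def by meson
  then obtain A where A: "\<And>x. x \<in> X \<Longrightarrow> h x \<notin> pts Q V \<Longrightarrow>
      A x \<in> dblocks T \<and> f x \<in> pts Q (A x) \<and> h x \<in> pts Q (A x)" by metis
  have "A x \<noteq> A y" if xy: "x \<in> X" "y \<in> X" "h x \<notin> pts Q V" "h y \<notin> pts Q V" "x \<noteq> y" for x y
  proof
    assume eq: "A x = A y"
    have "f x \<noteq> f y" "f x \<in> pts Q V" "f y \<in> pts Q V"
      using fan xy unfolding fan_def by (auto dest: inj_onD)
    then have "A x = V"
      using join_unique[OF Q _ V, of "A x" "f x" "f y"] A[OF xy(1,3)] A[OF xy(2,4)] eq by metis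
    then show False using A[OF xy(1,3)] xy(3) by blast
  qed
  then show ?thesis using that[of A] A by blast
qed

lemma ex_fan_of_inj:
  assumes inj: "inj_on h X" and g: "inj_on g (h ` X - pts Q V)" "g ` (h ` X - pts Q V) \<subseteq> pts Q V - h ` X"
    and join: "\<And>y. y \<in> h ` X - pts Q V \<Longrightarrow> \<exists>r \<in> nbrs Q. \<exists>s \<in> nbrs Q. r \<noteq> s \<and> y \<in> G r \<and> g y \<in> G s"
  shows "\<exists>f. fan Q V X h f"
proof -
  define g' where "g' y = (if y \<in> pts Q V then y else g y)" for y
  have "inj_on g' (h ` X)"
  proof (rule inj_onI)
    fix x y assume xy: "x \<in> h ` X" "y \<in> h ` X" "g' x = g' y"
    have *: "g z \<notin> h ` X" if "z \<in> h ` X" "z \<notin> pts Q V" for z using g(2) that by blast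
    show "x = y"
      using xy *[of x] *[of y] inj_onD[OF g(1), of x y]
      by (cases "x \<in> pts Q V"; cases "y \<in> pts Q V") (auto simp: g'_def)
  qed
  then have "inj_on (g' \<circ> h) X" using inj comp_inj_on by blast
  moreover have "(g' \<circ> h) ` X \<subseteq> pts Q V" using g(2) by (auto simp: g'_def)
  moreover have "\<exists>U \<in> dblocks T. g (h x) \<in> pts Q U \<and> h x \<in> pts Q U" if x: "x \<in> X" "h x \<notin> pts Q V" for x
    using join[of "h x"] x join_ex by (metis DiffI imageI)
  ultimately have "fan Q V X h (g' \<circ> h)" unfolding fan_def by (simp add: g'_def)
  then show ?thesis by blast
qed

lemma card_fan_le:
  assumes "Q \<in> blocks H\<^sub>0" "V \<in> dblocks T" "finite Y" "card Y \<le> \<Delta>"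
  shows "card (Y - pts Q V) \<le> card (pts Q V - Y)"
proof -
  have "card (Y - pts Q V) = card Y - card (Y \<inter> pts Q V)"
    using assms(3) by (simp add: card_Diff_subset_Int)
  moreover have "card (pts Q V - Y) = \<Delta> - card (Y \<inter> pts Q V)"
    using card_pts[OF assms(1,2)] assms(3) by (simp add: card_Diff_subset_Int Int_commute)
  ultimately show ?thesis using assms(4) by linarith
qed

text \<open>The last assumption says that the point of V in \<open>G p\<close> is already taken. All
  free points of V then lie in other groups and can be joined to any point of \<open>G p\<close>, so
  every injection works.\<close>

lemma ex_fan:
  assumes Q: "Q \<in> blocks H\<^sub>0" and V: "V \<in> dblocks T" and p: "p \<in> nbrs Q"
    and X: "inj_on h X" "finite X" "card X \<le> \<Delta>"
    and "h ` X - pts Q V \<subseteq> G p" "pts Q V \<inter> G p \<subseteq> h ` X"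
  shows "\<exists>f. fan Q V X h f"
proof -
  have "card (h ` X - pts Q V) \<le> card (pts Q V - h ` X)"
    using card_fan_le[OF Q V, of "h ` X"] X by (simp add: card_image)
  then obtain g where g: "inj_on g (h ` X - pts Q V)" "g ` (h ` X - pts Q V) \<subseteq> pts Q V - h ` X"
    using inj_on_iff_card_le[of "h ` X - pts Q V" "pts Q V - h ` X"] X(2) card_pts[OF Q V] by auto
  show ?thesis
  proof (rule ex_fan_of_inj[OF X(1) g])
    fix y assume y: "y \<in> h ` X - pts Q V"
    then have gy: "g y \<in> pts Q V" "g y \<notin> h ` X" using g(2) by blast+
    then obtain s where s: "s \<in> nbrs Q" "g y \<in> G s" using pts_cover[OF Q V] by blast
    then have "s \<noteq> p" using gy assms(8) by blast
    moreover have "y \<in> G p" using y assms(7) by (rule subsetD[rotated])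
    ultimately show "\<exists>r \<in> nbrs Q. \<exists>s \<in> nbrs Q. r \<noteq> s \<and> y \<in> G r \<and> g y \<in> G s"
      using s p by metis
  qed
qed

text \<open>The additional point y must not be matched with the point \<open>w\<close> of V in its
  own group. If y is off V, only the point of V in \<open>G p\<close> can be taken; thus at least
  \<Delta> - 1 \<ge> 2 points of V are free, and \<open>w\<close> can be avoided.\<close>

lemma ex_fan_extra:
  assumes Q: "Q \<in> blocks H\<^sub>0" and V: "V \<in> dblocks T" and p: "p \<in> nbrs Q"
    and q: "q \<in> nbrs Q" "q \<noteq> p" "y \<in> G q" and "3 \<le> \<Delta>"
    and X: "inj_on h X" "finite X" "card X \<le> \<Delta>"
    and sub: "h ` X \<subseteq> insert y (G p)" and hub: "pts Q V \<inter> G p \<subseteq> h ` X"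
  shows "\<exists>f. fan Q V X h f"
proof (cases "y \<in> h ` X - pts Q V")
  case False
  then show ?thesis using ex_fan[OF Q V p X _ hub] sub by blast
next
  case True
  have fin: "finite (pts Q V)" "card (pts Q V) = \<Delta>" using card_pts[OF Q V] by auto
  obtain v where v: "pts Q V \<inter> G p = {v}" using pts_Int_G[OF Q V p] .
  obtain w where w: "pts Q V \<inter> G q = {w}" using pts_Int_G[OF Q V q(1)] .
  have "pts Q V \<inter> h ` X \<subseteq> pts Q V \<inter> insert y (G p)" using sub by (rule Int_mono[OF subset_refl])
  also have "\<dots> = pts Q V \<inter> G p" using True by simp
  finally have "pts Q V \<inter> h ` X \<subseteq> {v}" unfolding v .
  then have "pts Q V - {v} \<subseteq> pts Q V - h ` X" by blast
  then have "card (pts Q V - {v}) \<le> card (pts Q V - h ` X)" using fin by (intro card_mono) auto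
  then have c2: "card (pts Q V - h ` X) \<ge> 2"
    using fin \<open>3 \<le> \<Delta>\<close> diff_card_le_card_Diff[of "{v}" "pts Q V"] by simp
  have "card (h ` X - pts Q V) \<le> card (pts Q V - h ` X)"
    using card_fan_le[OF Q V, of "h ` X"] X by (simp add: card_image)
  then obtain g where g: "inj_on g (h ` X - pts Q V)" "g ` (h ` X - pts Q V) \<subseteq> pts Q V - h ` X"
    "g y \<noteq> w"
    using ex_inj_on_avoiding[OF _ _ _ True c2, of w] X(2) fin by auto
  show ?thesis
  proof (rule ex_fan_of_inj[OF X(1) g(1,2)])
    fix z assume z: "z \<in> h ` X - pts Q V"
    then have gz: "g z \<in> pts Q V" "g z \<notin> h ` X" using g(2) by blast+
    then obtain s where s: "s \<in> nbrs Q" "g z \<in> G s" using pts_cover[OF Q V] by blast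
    show "\<exists>r \<in> nbrs Q. \<exists>s \<in> nbrs Q. r \<noteq> s \<and> z \<in> G r \<and> g z \<in> G s"
    proof (cases "z = y")
      case True
      then have "s \<noteq> q" using w gz(1) s(2) g(3) by (metis IntI singletonD)
      then show ?thesis using True s q by metis
    next
      case False
      then have "z \<in> G p" using z sub by blast
      moreover have "s \<noteq> p" using gz s hub by blast
      ultimately show ?thesis using s p by metis
    qed
  qed
qed

section \<open>Assembling paths between different copies\<close>

text \<open>Each path consists of a detour at Q, a link and a detour at Q'. The detours have at most
  two vertices each, and the path has one edge more than inner vertices, which explains the 5. Since
  common points of V and V' lie in X, the two fans cannot collide.\<close>

lemma disjoint_paths_from_fans:
  assumes Q: "Q \<in> blocks H\<^sub>0" "Q' \<in> blocks H\<^sub>0" "Q \<noteq> Q'" and V: "V \<in> dblocks T" "V' \<in> dblocks T"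
    and "finite X"
    and W: "\<And>x. x \<in> X \<Longrightarrow> successively (adjacent H) (W x) \<and> W x \<noteq> [] \<and> hd (W x) = Inl x \<and>
      last (W x) = Inl (h x) \<and> length (W x) + 5 \<le> m"
    and Wdisj: "\<And>x y. x \<in> X \<Longrightarrow> y \<in> X \<Longrightarrow> x \<noteq> y \<Longrightarrow> set (W x) \<inter> set (W y) = {}"
    and Wblocks: "\<And>x U. x \<in> X \<Longrightarrow> Inr (Q, U) \<notin> set (W x) \<and> Inr (Q', U) \<notin> set (W x)"
    and fan: "fan Q V X (\<lambda>x. x) f" "fan Q' V' X h f'"
    and avoid: "\<And>x y. x \<in> X \<Longrightarrow> x \<notin> pts Q V \<Longrightarrow> y \<in> X \<Longrightarrow> Inl (f x) \<notin> set (W y)"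
    and avoid': "\<And>x y. x \<in> X \<Longrightarrow> h x \<notin> pts Q' V' \<Longrightarrow> y \<in> X \<Longrightarrow> Inl (f' x) \<notin> set (W y)"
    and common: "pts Q V \<inter> pts Q' V' \<subseteq> X"
  shows "\<exists>P. disjoint_paths H (Inr (Q, V)) (Inr (Q', V')) (card X) m P"
proof -
  obtain A where A: "\<And>x. x \<in> X \<Longrightarrow> x \<notin> pts Q V \<Longrightarrow>
      A x \<in> dblocks T \<and> f x \<in> pts Q (A x) \<and> x \<in> pts Q (A x) \<and> A x \<noteq> V"
    "\<And>x y. x \<in> X \<Longrightarrow> y \<in> X \<Longrightarrow> x \<notin> pts Q V \<Longrightarrow> y \<notin> pts Q V \<Longrightarrow> x \<noteq> y \<Longrightarrow> A x \<noteq> A y"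
    using fan_blocks[OF Q(1) V(1) fan(1)] by blast
  obtain A' where A': "\<And>x. x \<in> X \<Longrightarrow> h x \<notin> pts Q' V' \<Longrightarrow>
      A' x \<in> dblocks T \<and> f' x \<in> pts Q' (A' x) \<and> h x \<in> pts Q' (A' x) \<and> A' x \<noteq> V'"
    "\<And>x y. x \<in> X \<Longrightarrow> y \<in> X \<Longrightarrow> h x \<notin> pts Q' V' \<Longrightarrow> h y \<notin> pts Q' V' \<Longrightarrow> x \<noteq> y \<Longrightarrow> A' x \<noteq> A' y"
    using fan_blocks[OF Q(2) V(2) fan(2)] by blast
  have f: "inj_on f X" "\<And>x. x \<in> X \<Longrightarrow> f x \<in> pts Q V" using fan(1) unfolding fan_def by auto
  have f': "inj_on f' X" "\<And>x. x \<in> X \<Longrightarrow> f' x \<in> pts Q' V'" using fan(2) unfolding fan_def by auto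
  have ff': "f x \<noteq> f' y" if "x \<in> X" "y \<in> X" "x \<notin> pts Q V" for x y
  proof
    assume "f x = f' y"
    \<comment> \<open>The point would belong to both V and V' and hence be the start of a link,
      which \<open>fan_new\<close> excludes.\<close>
    then have "f x \<in> X" using common f(2) f'(2) that by force
    then show False using fan_new[OF fan(1) that(1)] that(3) by blast
  qed
  define pre where "pre x = (if x \<in> pts Q V then [] else [Inl (f x), Inr (Q, A x)])" for x
  define post where "post x = (if h x \<in> pts Q' V' then [] else [Inr (Q', A' x), Inl (f' x)])" for x
  have walk: "successively (adjacent H) (Inr (Q, V) # (pre x @ W x @ post x) @ [Inr (Q', V')])"
    if x: "x \<in> X" for x
    using W[OF x] A(1)[OF x] A'(1)[OF x] f(2)[OF x] f'(2)[OF x] Q V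
    by (auto simp: pre_def post_def successively_Cons successively_append_iff nbrs_H hd_append)
  have disj: "set (pre x @ W x @ post x) \<inter> set (pre y @ W y @ post y) = {}"
    if xy: "x \<in> X" "y \<in> X" "x \<noteq> y" for x y
  proof -
    have 1: "set (pre x) \<inter> set (pre y) = {}"
      using A(2)[OF xy(1,2)] inj_onD[OF f(1) _ xy(1,2)] xy(3) by (auto simp: pre_def)
    have 2: "set (post x) \<inter> set (post y) = {}"
      using A'(2)[OF xy(1,2)] inj_onD[OF f'(1) _ xy(1,2)] xy(3) by (auto simp: post_def)
    have 3: "set (pre x) \<inter> set (W y) = {}" if "x \<in> X" "y \<in> X" for x y
      using avoid[of x y] Wblocks[of y] that by (auto simp: pre_def)
    have 4: "set (post x) \<inter> set (W y) = {}" if "x \<in> X" "y \<in> X" for x y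
      using avoid'[of x y] Wblocks[of y] that by (auto simp: post_def)
    have 5: "set (pre x) \<inter> set (post y) = {}" if "x \<in> X" "y \<in> X" for x y
      using ff'[of x y] Q(3) that by (auto simp: pre_def post_def)
    show ?thesis
      using 1 2 3[of x y] 3[of y x] 4[of x y] 4[of y x] 5[of x y] 5[of y x] Wdisj[OF xy] xy(1,2)
      unfolding set_append by blast
  qed
  have ends: "Inr (Q, V) \<notin> set (pre x @ W x @ post x) \<and> Inr (Q', V') \<notin> set (pre x @ W x @ post x)"
    if x: "x \<in> X" for x
    using Wblocks[OF x] A(1)[OF x] A'(1)[OF x] Q(3) by (auto simp: pre_def post_def)
  have len: "length (pre x @ W x @ post x) < m" if x: "x \<in> X" for x
    using W[OF x] by (auto simp: pre_def post_def)
  show ?thesis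
    using disjoint_pathsI_walks[OF wf_H \<open>finite X\<close> _ _ walk len ends disj] Q(3) by simp
qed

lemma disjoint_paths_one_route:
  assumes Q: "Q \<in> blocks H\<^sub>0" "Q' \<in> blocks H\<^sub>0" "Q \<noteq> Q'" and V: "V \<in> dblocks T" "V' \<in> dblocks T"
    and common: "pts Q V \<inter> pts Q' V' = {}"
    and route: "route H\<^sub>0 Q Q' p p' ys" and len: "length ys < m"
    and n: "2 \<le> n" "n \<le> \<Delta>" "n \<le> k"
  shows "\<exists>P. disjoint_paths H (Inr (Q, V)) (Inr (Q', V')) n (m + 4) P"
proof -
  have r: "p \<in> nbrs Q" "p' \<in> nbrs Q'" "\<forall>r \<in> nbrs Q. Inl r \<in> set ys \<longrightarrow> r = p"
    "\<forall>r \<in> nbrs Q'. Inl r \<in> set ys \<longrightarrow> r = p'" "Inr Q \<notin> set ys" "Inr Q' \<notin> set ys"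
    using route unfolding route_def by auto
  have nodes: "p \<in> nodes H\<^sub>0" "p' \<in> nodes H\<^sub>0" using r nbrs_node by blast+
  obtain W h where link: "link p p' ys W h"
    using ex_link[OF _ _ _ _ _ nodes(1)] route unfolding route_def by blast
  have h: "inj_on h (G p)" "h ` G p = G p'" using link_bij[OF link nodes] unfolding bij_betw_def by auto
  obtain v where v: "pts Q V \<inter> G p = {v}" using pts_Int_G[OF Q(1) V(1) r(1)] .
  obtain v' where v': "pts Q' V' \<inter> G p' = {v'}" using pts_Int_G[OF Q(2) V(2) r(2)] .
  \<comment> \<open>Two starts are fixed in advance, \<open>v\<close> for the fan at Q and
    \<open>w\<close>, whose link ends in \<open>v'\<close>, for the fan at Q'. They may coincide,
    and n \<ge> 2 leaves room for both.\<close>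
  have "v' \<in> h ` G p" using v' unfolding h(2) by blast
  then obtain w where w: "w \<in> G p" "h w = v'" by blast
  have "card {v, w} \<le> n" using n(1) card_insert_le_m1[of 2 "{w}" v] by (simp add: card_insert_if)
  moreover have "{v, w} \<subseteq> G p" using v w by blast
  ultimately obtain X where X: "{v, w} \<subseteq> X" "X \<subseteq> G p" "card X = n"
    using exists_subset_between[of "{v, w}" n "G p"] card_G[OF nodes(1)] n(3) by auto
  have fin: "finite X" using X(2) card_G[OF nodes(1)] finite_subset by blast
  have inj: "inj_on h X" using h(1) X(2) inj_on_subset by blast
  obtain f where f: "fan Q V X (\<lambda>x. x) f"
    using ex_fan[OF Q(1) V(1) r(1), of "\<lambda>x. x" X] fin X n v by auto
  have "h ` X \<subseteq> G p'" using X(2) h(2) by blast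
  moreover have "pts Q' V' \<inter> G p' \<subseteq> h ` X" unfolding v' using X(1) w(2) by blast
  ultimately obtain f' where f': "fan Q' V' X h f'"
    using ex_fan[OF Q(2) V(2) r(2) inj fin] X(3) n by blast
  have over: "set (W y) \<subseteq> over (set ys)" if "y \<in> X" for y using link that X(2) unfolding link_def by blast
  have "\<exists>P. disjoint_paths H (Inr (Q, V)) (Inr (Q', V')) (card X) (m + 4) P"
  proof (rule disjoint_paths_from_fans[OF Q V fin _ _ _ f f'])
    fix x assume x: "x \<in> X"
    then show "successively (adjacent H) (W x) \<and> W x \<noteq> [] \<and> hd (W x) = Inl x \<and>
      last (W x) = Inl (h x) \<and> length (W x) + 5 \<le> m + 4"
      using link X(2) len unfolding link_def by auto
    show "Inr (Q, U) \<notin> set (W x) \<and> Inr (Q', U) \<notin> set (W x)" for U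
      using over[OF x] Inr_over r(5,6) by blast
    fix y assume y: "y \<in> X"
    show "set (W x) \<inter> set (W y) = {}" if "x \<noteq> y"
      using link X(2) x y that unfolding link_def by blast
    show "Inl (f x) \<notin> set (W y)" if nx: "x \<notin> pts Q V"
    proof -
      have "f x \<in> pts Q V" using f x unfolding fan_def by blast
      moreover have "f x \<noteq> v" using fan_new[OF f x nx] X(1) by blast
      ultimately show ?thesis using Inl_notin_over[OF Q(1) V(1) _ r(3)] v over[OF y] by blast
    qed
    show "Inl (f' x) \<notin> set (W y)" if nx: "h x \<notin> pts Q' V'"
    proof -
      have "f' x \<in> pts Q' V'" using f' x unfolding fan_def by blast
      moreover have "f' x \<noteq> v'" using fan_new[OF f' x nx, of w] X(1) w(2) by simp
      ultimately have "f' x \<notin> G p'" using v' by (metis IntI singletonD)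
      then show ?thesis using Inl_notin_over[OF Q(2) V(2) \<open>f' x \<in> pts Q' V'\<close> r(4)] over[OF y] by blast
    qed
  qed (use common in auto)
  then show ?thesis using X(3) by simp
qed

text \<open>One group serves both ends, so the links are single vertices; with two detours this
  gives at most five inner vertices. The point c is the point of both V and V' in
  \<open>G p\<close>. Members of X outside \<open>G p\<close> are common points and need no
  detour.\<close>

lemma disjoint_paths_common_point:
  assumes Q: "Q \<in> blocks H\<^sub>0" "Q' \<in> blocks H\<^sub>0" "Q \<noteq> Q'" and V: "V \<in> dblocks T" "V' \<in> dblocks T"
    and c: "c \<in> pts Q V" "c \<in> pts Q' V'" "c \<in> G p" and p: "p \<in> nbrs Q" "p \<in> nbrs Q'"
    and m: "6 \<le> m"
  shows "\<exists>P. disjoint_paths H (Inr (Q, V)) (Inr (Q', V'))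
    (min \<Delta> (card (pts Q V \<inter> pts Q' V' \<union> G p))) m P"
proof -
  let ?C = "pts Q V \<inter> pts Q' V'"
  have fC: "finite (?C \<union> G p)" using card_pts[OF Q(1) V(1)] card_G[OF nbrs_node[OF p(1)]] by auto
  have "card ?C \<le> \<Delta>" using card_pts[OF Q(1) V(1)] card_mono[of "pts Q V" ?C] by auto
  moreover have "card ?C \<le> card (?C \<union> G p)" using fC by (intro card_mono) auto
  ultimately obtain X where X: "?C \<subseteq> X" "X \<subseteq> ?C \<union> G p" "card X = min \<Delta> (card (?C \<union> G p))"
    using exists_subset_between[of ?C "min \<Delta> (card (?C \<union> G p))" "?C \<union> G p"] fC by auto
  have fin: "finite X" using X(2) fC finite_subset by blast
  have hub: "pts Q V \<inter> G p \<subseteq> X" "pts Q' V' \<inter> G p \<subseteq> X"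
    using pts_same_group[OF V(1) p(1)] pts_same_group[OF V(2) p(2)] c X(1) by blast+
  have "X - pts Q V \<subseteq> G p" "X - pts Q' V' \<subseteq> G p" using X(2) by blast+
  then obtain f f' where f: "fan Q V X (\<lambda>x. x) f" and f': "fan Q' V' X (\<lambda>x. x) f'"
    using ex_fan[OF Q(1) V(1) p(1), of "\<lambda>x. x" X] ex_fan[OF Q(2) V(2) p(2), of "\<lambda>x. x" X]
      fin X(3) hub by auto
  have "\<exists>P. disjoint_paths H (Inr (Q, V)) (Inr (Q', V')) (card X) m P"
    by (rule disjoint_paths_from_fans[OF Q V fin _ _ _ f f', of "\<lambda>x. [Inl x]"])
      (use m X(1) fan_new[OF f] fan_new[OF f'] in auto)
  then show ?thesis using X(3) by simp
qed

text \<open>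
  All of \<open>G p\<close> is linked along the first route; the one missing path starts at the point of \<open>V\<close> above
  the second route.
\<close>

lemma disjoint_paths_two_routes:
  assumes Q: "Q \<in> blocks H\<^sub>0" "Q' \<in> blocks H\<^sub>0" "Q \<noteq> Q'" and V: "V \<in> dblocks T" "V' \<in> dblocks T"
    and common: "pts Q V \<inter> pts Q' V' \<subseteq> G p" and \<Delta>: "\<Delta> = k + 1"
    and route: "route H\<^sub>0 Q Q' p p' ys" and len: "length ys < m"
    and route': "route H\<^sub>0 Q Q' q q' zs" and len': "length zs < m"
    and disj: "set ys \<inter> set zs = {}"
  shows "\<exists>P. disjoint_paths H (Inr (Q, V)) (Inr (Q', V')) \<Delta> (m + 4) P"
proof -
  have r: "p \<in> nbrs Q" "p' \<in> nbrs Q'" "\<forall>r \<in> nbrs Q. Inl r \<in> set ys \<longrightarrow> r = p"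
    "\<forall>r \<in> nbrs Q'. Inl r \<in> set ys \<longrightarrow> r = p'" "Inr Q \<notin> set ys" "Inr Q' \<notin> set ys"
    "Inl p \<in> set ys" "Inl p' \<in> set ys"
    using route hd_in_set last_in_set unfolding route_def by metis+
  have s: "q \<in> nbrs Q" "q' \<in> nbrs Q'" "\<forall>r \<in> nbrs Q. Inl r \<in> set zs \<longrightarrow> r = q"
    "\<forall>r \<in> nbrs Q'. Inl r \<in> set zs \<longrightarrow> r = q'" "Inr Q \<notin> set zs" "Inr Q' \<notin> set zs"
    "Inl q \<in> set zs" "Inl q' \<in> set zs"
    using route' hd_in_set last_in_set unfolding route_def by metis+
  have neq: "q \<noteq> p" "q' \<noteq> p'" using r(7,8) s(7,8) disj by blast+
  have nodes: "p \<in> nodes H\<^sub>0" "p' \<in> nodes H\<^sub>0" "q \<in> nodes H\<^sub>0" "q' \<in> nodes H\<^sub>0"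
    using r s nbrs_node by blast+
  obtain W\<^sub>1 h\<^sub>1 where link: "link p p' ys W\<^sub>1 h\<^sub>1"
    using ex_link[OF _ _ _ _ _ nodes(1)] route unfolding route_def by blast
  obtain W\<^sub>2 h\<^sub>2 where link': "link q q' zs W\<^sub>2 h\<^sub>2"
    using ex_link[OF _ _ _ _ _ nodes(3)] route' unfolding route_def by blast
  have h\<^sub>1: "inj_on h\<^sub>1 (G p)" "h\<^sub>1 ` G p = G p'"
    using link_bij[OF link nodes(1,2)] unfolding bij_betw_def by auto
  obtain v where v: "pts Q V \<inter> G q = {v}" using pts_Int_G[OF Q(1) V(1) s(1)] .
  have vq: "v \<in> G q" "v \<in> pts Q V" using v by blast+
  have vp: "v \<notin> G p" using vq(1) G_disjoint nodes neq(1) by blast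
  have hv: "h\<^sub>2 v \<in> G q'" using link' vq(1) unfolding link_def by blast
  have hvp: "h\<^sub>2 v \<notin> G p'" using hv G_disjoint nodes neq(2) by blast
  define X where "X = insert v (G p)"
  define W where "W x = (if x \<in> G p then W\<^sub>1 x else W\<^sub>2 x)" for x
  define h where "h x = (if x \<in> G p then h\<^sub>1 x else h\<^sub>2 x)" for x
  have hX: "h ` X = insert (h\<^sub>2 v) (G p')" using h\<^sub>1(2) vp by (auto simp: X_def h_def)
  have fin: "finite X" "card X = \<Delta>" using card_G[OF nodes(1)] vp \<Delta> by (auto simp: X_def)
  have inj: "inj_on h X"
  proof (rule eq_card_imp_inj_on[OF fin(1)])
    show "card (h ` X) = card X" unfolding hX fin(2) using card_G[OF nodes(2)] hvp \<Delta> by simp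
  qed
  \<comment> \<open>At Q the additional start \<open>v\<close> lies in V and needs no detour. At Q'
    the end \<open>h\<^sub>2 v\<close> may miss V', so the stronger fan lemma is required
    there.\<close>
  obtain f where f: "fan Q V X (\<lambda>x. x) f"
    using ex_fan[OF Q(1) V(1) r(1), of "\<lambda>x. x" X] fin vq(2) by (auto simp: X_def)
  have "3 \<le> \<Delta>" using \<Delta> params by simp
  then obtain f' where f': "fan Q' V' X h f'"
    using ex_fan_extra[OF Q(2) V(2) r(2) s(2) neq(2) hv _ inj] fin unfolding hX by blast
  have Wcase: "x \<in> G p \<and> W x = W\<^sub>1 x \<and> h x = h\<^sub>1 x \<and> set (W x) \<subseteq> over (set ys) \<or>
      x = v \<and> W x = W\<^sub>2 v \<and> h x = h\<^sub>2 v \<and> set (W x) \<subseteq> over (set zs)" if "x \<in> X" for x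
    using that vp vq(1) link link' unfolding X_def W_def h_def link_def by auto
  have over: "over (set ys) \<inter> over (set zs) = {}" using over_disjoint disj by blast
  have "\<exists>P. disjoint_paths H (Inr (Q, V)) (Inr (Q', V')) (card X) (m + 4) P"
  proof (rule disjoint_paths_from_fans[OF Q V fin(1) _ _ _ f f'])
    fix x assume x: "x \<in> X"
    show "successively (adjacent H) (W x) \<and> W x \<noteq> [] \<and> hd (W x) = Inl x \<and>
      last (W x) = Inl (h x) \<and> length (W x) + 5 \<le> m + 4"
      using Wcase[OF x] link link' len len' vq(1) unfolding link_def by auto
    show "Inr (Q, U) \<notin> set (W x) \<and> Inr (Q', U) \<notin> set (W x)" for U
      using Wcase[OF x] Inr_over r(5,6) s(5,6) by blast
    fix y assume y: "y \<in> X"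
    show "set (W x) \<inter> set (W y) = {}" if "x \<noteq> y"
    proof (cases "x \<in> G p \<and> y \<in> G p")
      case True
      then show ?thesis using link that unfolding link_def W_def by auto
    next
      case False
      then show ?thesis using Wcase[OF x] Wcase[OF y] that over by blast
    qed
    show "Inl (f x) \<notin> set (W y)" if nx: "x \<notin> pts Q V"
    proof -
      have fx: "f x \<in> pts Q V" using f x unfolding fan_def by blast
      have "f x \<notin> X" using fan_new[OF f x nx] by blast
      then have "f x \<notin> G p" "f x \<notin> G q" using fx v unfolding X_def by blast+
      then show ?thesis
        using Inl_notin_over[OF Q(1) V(1) fx r(3)] Inl_notin_over[OF Q(1) V(1) fx s(3)] Wcase[OF y]
        by blast
    qed
    show "Inl (f' x) \<notin> set (W y)" if nx: "h x \<notin> pts Q' V'"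
    proof -
      have fx: "f' x \<in> pts Q' V'" using f' x unfolding fan_def by blast
      have fX: "f' x \<notin> h ` X" using fan_new[OF f' x nx] by blast
      then have "f' x \<notin> G p'" unfolding hX by blast
      then have 1: "Inl (f' x) \<notin> over (set ys)" using Inl_notin_over[OF Q(2) V(2) fx r(4)] by blast
      \<comment> \<open>Unlike at Q, the fan at Q' may use a point of \<open>G q'\<close>; the
        single walk of the second link meets this group only in \<open>h\<^sub>2 v\<close>.\<close>
      have "Inl (f' x) \<notin> set (W\<^sub>2 v)"
      proof
        assume a: "Inl (f' x) \<in> set (W\<^sub>2 v)"
        moreover have "set (W\<^sub>2 v) \<subseteq> over (set zs)" using link' vq(1) unfolding link_def by blast
        ultimately have "f' x \<in> G q'" using Inl_notin_over[OF Q(2) V(2) fx s(4)] by blast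
        then have "f' x = h\<^sub>2 v" using link' vq(1) a unfolding link_def by blast
        then show False using fX unfolding hX by blast
      qed
      then show ?thesis using 1 Wcase[OF y] by auto
    qed
  qed (use common in \<open>auto simp: X_def\<close>)
  then show ?thesis using fin(2) by simp
qed

lemma disjoint_paths_different_copies:
  assumes Q: "Q \<in> blocks H\<^sub>0" "Q' \<in> blocks H\<^sub>0" "Q \<noteq> Q'" and V: "V \<in> dblocks T" "V' \<in> dblocks T"
    and P: "disjoint_paths H\<^sub>0 (Inr Q) (Inr Q') l m P"
  shows "1 \<le> l \<Longrightarrow> \<exists>P. disjoint_paths H (Inr (Q, V)) (Inr (Q', V')) (min \<Delta> k) (m + 4) P"
    and "2 \<le> l \<Longrightarrow> \<exists>P. disjoint_paths H (Inr (Q, V)) (Inr (Q', V')) \<Delta> (m + 4) P"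
proof -
  let ?C = "pts Q V \<inter> pts Q' V'"
  have P': "finite P" "card P = l" "\<And>xs. xs \<in> P \<Longrightarrow> path_between H\<^sub>0 (Inr Q) (Inr Q') xs"
    "\<And>xs. xs \<in> P \<Longrightarrow> path_length xs \<le> m"
    using P unfolding disjoint_paths_def by auto
  have ex: "\<exists>p p' ys. route H\<^sub>0 Q Q' p p' ys \<and> set ys \<subseteq> set xs - {Inr Q, Inr Q'} \<and> length ys < m"
    if "xs \<in> P" for xs
    using ex_route[OF P'(3)[OF that] Q(3)] P'(4)[OF that] by (metis order_less_le_trans)
  \<comment> \<open>Different blocks have distance at least 2, so m + 4 leaves room for the paths of
    length 6 through a group above a common neighbour.\<close>
  have m2: "2 \<le> m" if "1 \<le> l"
  proof -
    obtain xs where "xs \<in> P" using P'(2) \<open>1 \<le> l\<close> by fastforce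
    then obtain p p' ys where "route H\<^sub>0 Q Q' p p' ys" "length ys < m" using ex by blast
    moreover have "length ys \<ge> 1" using \<open>route H\<^sub>0 Q Q' p p' ys\<close> by (cases ys) (auto simp: route_def)
    ultimately show ?thesis by linarith
  qed
  have hub: "\<exists>p. c \<in> G p \<and> p \<in> nbrs Q \<and> p \<in> nbrs Q'" if "c \<in> ?C" for c
    using pts_cover[OF Q(1) V(1), of c] pts_cover[OF Q(2) V(2), of c] that G_disjoint nbrs_node
    by (metis IntD1 IntD2)
  show one: "\<exists>P. disjoint_paths H (Inr (Q, V)) (Inr (Q', V')) (min \<Delta> k) (m + 4) P" if l: "1 \<le> l"
  proof (cases "?C = {}")
    case True
    obtain xs where "xs \<in> P" using P'(2) l by fastforce
    then obtain p p' ys where "route H\<^sub>0 Q Q' p p' ys" "length ys < m" using ex by blast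
    then show ?thesis using disjoint_paths_one_route[OF Q V True] params by simp
  next
    case False
    then obtain c where c: "c \<in> ?C" by blast
    then obtain p where p: "c \<in> G p" "p \<in> nbrs Q" "p \<in> nbrs Q'" using hub by blast
    have "card (G p) \<le> card (?C \<union> G p)"
      using card_pts[OF Q(1) V(1)] card_G[OF nbrs_node[OF p(2)]] by (intro card_mono) auto
    then have "min \<Delta> k \<le> min \<Delta> (card (?C \<union> G p))" using card_G[OF nbrs_node[OF p(2)]] by simp
    moreover obtain P where "disjoint_paths H (Inr (Q, V)) (Inr (Q', V')) (min \<Delta> (card (?C \<union> G p))) (m + 4) P"
      using disjoint_paths_common_point[OF Q V _ _ p, of "m + 4"] c m2[OF l] by auto
    ultimately show ?thesis using disjoint_paths_fewer by blast
  qed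
  show "\<exists>P. disjoint_paths H (Inr (Q, V)) (Inr (Q', V')) \<Delta> (m + 4) P" if l: "2 \<le> l"
  proof (cases "\<Delta> \<le> k")
    case True
    then show ?thesis using one l by (simp add: min_absorb1)
  next
    case False
    then have \<Delta>: "\<Delta> = k + 1" using \<Delta>_le[OF Q(1)] by simp
    have "\<not> card P \<le> Suc 0" using P'(2) l by simp
    then obtain xs xs' where xs: "xs \<in> P" "xs' \<in> P" "xs \<noteq> xs'"
      using card_le_Suc0_iff_eq[OF P'(1)] by blast
    obtain p p' ys where ys: "route H\<^sub>0 Q Q' p p' ys" "set ys \<subseteq> set xs - {Inr Q, Inr Q'}" "length ys < m"
      using ex[OF xs(1)] by blast
    obtain q q' zs where zs: "route H\<^sub>0 Q Q' q q' zs" "set zs \<subseteq> set xs' - {Inr Q, Inr Q'}" "length zs < m"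
      using ex[OF xs(2)] by blast
    have "hd ` P \<union> last ` P \<subseteq> {Inr Q, Inr Q'}" using P'(3) unfolding path_between_def by auto
    moreover have "set xs \<inter> set xs' \<subseteq> hd ` P \<union> last ` P"
      using P xs unfolding disjoint_paths_def internally_disjoint_def Let_def by blast
    ultimately have "set xs \<inter> set xs' \<subseteq> {Inr Q, Inr Q'}" by (rule subset_trans[rotated])
    then have disj: "set ys \<inter> set zs = {}" using ys(2) zs(2) by blast
    show ?thesis
    proof (cases "?C = {}")
      case True
      then show ?thesis using disjoint_paths_two_routes[OF Q V _ \<Delta> ys(1,3) zs(1,3) disj] by simp
    next
      case False
      then obtain c where c: "c \<in> ?C" by blast
      then obtain r where r: "c \<in> G r" "r \<in> nbrs Q" "r \<in> nbrs Q'" using hub by blast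
      have m: "2 \<le> m" using m2 l by simp
      show ?thesis
      \<comment> \<open>If all common points lie in \<open>G r\<close>, the node \<open>r\<close>
        alone is the first route, and one of the two given routes avoids it. Otherwise a common
        point outside \<open>G r\<close> supplies the missing path, since k + 1 = \<Delta>.\<close>
      proof (cases "?C \<subseteq> G r")
        case True
        have route: "route H\<^sub>0 Q Q' r r [Inl r]" using r by (simp add: route_singleton)
        consider "Inl r \<notin> set ys" | "Inl r \<notin> set zs" using disj by blast
        then show ?thesis
        proof cases
          case 1
          then show ?thesis
            using disjoint_paths_two_routes[OF Q V True \<Delta> route _ ys(1,3)] m by simp
        next
          case 2
          then show ?thesis
            using disjoint_paths_two_routes[OF Q V True \<Delta> route _ zs(1,3)] m by simp
        qed
      next
        case False
        then obtain c' where c': "c' \<in> ?C" "c' \<notin> G r" by blast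
        have G: "finite (G r)" "card (G r) = k" using card_G[OF nbrs_node[OF r(2)]] by auto
        have "card (insert c' (G r)) \<le> card (?C \<union> G r)"
          using c'(1) card_pts[OF Q(1) V(1)] G by (intro card_mono) auto
        then have "min \<Delta> (card (?C \<union> G r)) = \<Delta>" using c'(2) G \<Delta> by simp
        then show ?thesis
          using disjoint_paths_common_point[OF Q V _ _ r, of "m + 4"] c m by simp
      qed
    qed
  qed
qed

end

theorem theorem2:
  fixes k \<Delta> d :: nat
    and H\<^sub>0 :: "('p, 'q) bigraph"
    and T :: "'a design"
    and G :: "'p \<Rightarrow> 'v set"
    and \<sigma> :: "'q \<Rightarrow> nat \<Rightarrow> 'p"
    and \<phi> :: "'q \<Rightarrow> 'a \<Rightarrow> 'v"
    and H :: "('v, 'q \<times> 'a set) bigraph"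
  assumes "k \<ge> 2" and "\<Delta> \<ge> 2" and "d \<ge> 2"
    and "biregular d \<Delta> H\<^sub>0" and "connected_bigraph H\<^sub>0"
    and "transversal_design \<Delta> k T"
    and "two_step_data \<Delta> k H\<^sub>0 T G \<sigma> \<phi>"
    and "H = two_step H\<^sub>0 T G \<phi>"
  shows
    "(\<forall>Q \<in> blocks H\<^sub>0. \<forall>Q' \<in> blocks H\<^sub>0. \<forall>(l::nat) (\<mu>::nat).
        Q \<noteq> Q' \<and> l \<ge> 1 \<and> (\<exists>P. disjoint_paths H\<^sub>0 (Inr Q) (Inr Q') l \<mu> P) \<longrightarrow>
        (\<forall>V V'. (Q, V) \<in> blocks H \<and> (Q', V') \<in> blocks H \<longrightarrow>
           (\<exists>P. disjoint_paths H (Inr (Q, V)) (Inr (Q', V')) (min \<Delta> k) (\<mu> + 4) P) \<and>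
           (l \<ge> 2 \<longrightarrow>
             (\<exists>P. disjoint_paths H (Inr (Q, V)) (Inr (Q', V')) \<Delta> (\<mu> + 4) P))))
     \<and>
     (\<forall>Q V V'. (Q, V) \<in> blocks H \<and> (Q, V') \<in> blocks H \<and> V \<noteq> V' \<longrightarrow>
        (\<exists>P. disjoint_paths H (Inr (Q, V)) (Inr (Q, V')) \<Delta> 6 P \<and>
             (\<forall>xs \<in> P. is_path (design_copy T \<phi> Q) xs)))"
proof -
  interpret two_step_method k \<Delta> H\<^sub>0 T G \<sigma> \<phi>
    using assms unfolding biregular_def by unfold_locales auto
  have same: "\<exists>P. disjoint_paths H (Inr (Q, V)) (Inr (Q, V')) \<Delta> 6 P \<and>
      (\<forall>xs \<in> P. is_path (design_copy T \<phi> Q) xs)"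
    if VV': "(Q, V) \<in> blocks H \<and> (Q, V') \<in> blocks H \<and> V \<noteq> V'" for Q V V'
  proof -
    have Q: "Q \<in> blocks H\<^sub>0" and V: "V \<in> dblocks T" "V' \<in> dblocks T" "V \<noteq> V'"
      using VV' assms(8) blocks_H by auto
    obtain P where P: "disjoint_paths (design_copy T \<phi> Q) (Inr (Q, V)) (Inr (Q, V')) \<Delta> 6 P"
      using disjoint_paths_same_copy[OF Q V] by blast
    then show ?thesis
      using disjoint_paths_supergraph[OF P copy_subgraph[OF Q]] assms(8)
      unfolding disjoint_paths_def path_between_def by blast
  qed
  have different: "(\<exists>P. disjoint_paths H (Inr (Q, V)) (Inr (Q', V')) (min \<Delta> k) (\<mu> + 4) P) \<and>
      (l \<ge> 2 \<longrightarrow> (\<exists>P. disjoint_paths H (Inr (Q, V)) (Inr (Q', V')) \<Delta> (\<mu> + 4) P))"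
    if paths: "Q \<noteq> Q' \<and> l \<ge> 1 \<and> (\<exists>P. disjoint_paths H\<^sub>0 (Inr Q) (Inr Q') l \<mu> P)"
      and VV': "(Q, V) \<in> blocks H \<and> (Q', V') \<in> blocks H"
    for Q Q' l \<mu> V V'
  proof -
    obtain P where P: "disjoint_paths H\<^sub>0 (Inr Q) (Inr Q') l \<mu> P" using paths by blast
    show ?thesis
      using disjoint_paths_different_copies[OF _ _ _ _ _ P] paths VV' assms(8) blocks_H by simp
  qed
  show ?thesis
    by (rule conjI; intro ballI allI impI) (rule different same; assumption)+
qed

end
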